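(* Let $0<\lambda\le\Lambda$ and let $\Omega\subset\mathbb{R}^n$ be a domain that satisfies the interior $C^{1,\mathrm{Dini}}$ condition at $0\in\partial\Omega$, with corresponding Dini function $\omega_\Omega$. Suppose that $u$ satisfies $$\mathcal{M}^-(D^2u,\lambda,\Lambda)\le0\ \text{ in }\ \Omega\cap B_1\quad(\text{i.e., } u\in\bar S(\lambda,\Lambda,0)\text{ in }\Omega\cap B_1),$$ with $u(0)=0$ and $u\ge0$ in $\Omega\cap B_1$. Then for any $l=(l_1,\dots,l_n)\in\mathbb{R}^n$ with $|l|=1$ and $l_n>0$, $$u(rl)\ge c\,l_n\left(\inf_{x\in B_{1/8}(e_n/2)}u(x)\right)r\qquad\text{for all } 0<r<\delta,$$ where $c>0$ depends only on $n,\lambda,\Lambda$ and $\omega_\Omega$, and $\delta>0$ depends only on $n,\lambda,\Lambda,\omega_\Omega$ and $l$.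
   Context: Notation: $B_r(x_0)$ is the open ball of radius $r$ centered at $x_0$ in $\mathbb{R}^n$, $B_r=B_r(0)$; $x=(x',x_n)$ with $x'\in\mathbb{R}^{n-1}$; $e_n=(0,\dots,0,1)$. Dini function: a nondecreasing function $\omega:[0,+\infty)\to[0,+\infty)$ such that, for some $r_0>0$, $\int_0^{r_0}\frac{\omega(r)}{r}\,dr<\infty$. Interior $C^{1,\mathrm{Dini}}$ condition at $0\in\partial\Omega$: there exist $r_0>0$, a coordinate system $\{x_1,\dots,x_n\}$ with origin at the boundary point $0$, and a Dini function $\omega_\Omega$ such that $$B_{r_0}\cap\{x_n>|x'|\omega_\Omega(|x'|)\}\subset B_{r_0}\cap\Omega.$$ It is assumed throughout that $r_0=1$ and $\omega_\Omega(1)<1/4$. The claim is expressed in this coordinate system. Pucci extremal operator: for a symmetric $n\times n$ matrix $M$ with eigenvalues $\lambda_1,\dots,\lambda_n$, $$\mathcal{M}^-(M,\lambda,\Lambda)=\lambda\sum_{\lambda_i>0}\lambda_i+\Lambda\sum_{\lambda_i<0}\lambda_i.$$ Pucci class: for $D\subset\mathbb{R}^n$ open, $u\in\bar S(\lambda,\Lambda,0)$ in $D$ (also written $\mathcal{M}^-(D^2u,\lambda,\Lambda)\le0$ in $D$) means that $u\in C(D)$ is an $L^n$-viscosity supersolution of $\mathcal{M}^-(D^2u,\lambda,\Lambda)=0$ in $D$: whenever $\varphi\in W^{2,n}(D)$ and $u-\varphi$ attains a local minimum at $x\in D$, one has $\mathrm{ess}\liminf_{y\to x}\mathcal{M}^-(D^2\varphi(y),\lambda,\Lambda)\le0$.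 *)

theory Defs
  imports "HOL-Analysis.Analysis"
begin

definition dini_function :: "(real \<Rightarrow> real) \<Rightarrow> bool" where
  "dini_function \<omega> \<longleftrightarrow>
     mono_on {0..} \<omega> \<and> (\<forall>r\<ge>0. 0 \<le> \<omega> r) \<and>
     (\<exists>r0>0. set_integrable lborel {0<..<r0} (\<lambda>r. \<omega> r / r))"

text \<open>
  The index \<open>N\<close> plays the role of the last coordinate: \<open>x $ N\<close> is \<open>x\<^sub>n\<close>,
  \<open>axis N 1\<close> is \<open>e\<^sub>n\<close>, and \<open>x'\<close> collects the remaining coordinates.
\<close>

definition tangential_norm :: "'n::finite \<Rightarrow> real^'n \<Rightarrow> real" where
  "tangential_norm N x = L2_set (\<lambda>i. x $ i) (- {N})"

text \<open>
  The condition at the boundary point \<open>0\<close>, for given radius \<open>r0\<close> and Dini function \<open>\<omega>\<close>,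
  written in the coordinate system that realises it.
\<close>

definition interior_C1_Dini :: "'n::finite \<Rightarrow> real \<Rightarrow> (real \<Rightarrow> real) \<Rightarrow> (real^'n) set \<Rightarrow> bool" where
  "interior_C1_Dini N r0 \<omega> \<Omega> \<longleftrightarrow>
     0 < r0 \<and> dini_function \<omega> \<and> 0 \<in> frontier \<Omega> \<and>
     ball 0 r0 \<inter> {x. x $ N > tangential_norm N x * \<omega> (tangential_norm N x)} \<subseteq> ball 0 r0 \<inter> \<Omega>"

definition partial_deriv :: "'n::finite \<Rightarrow> (real^'n \<Rightarrow> real) \<Rightarrow> real^'n \<Rightarrow> real" where
  "partial_deriv i f x = frechet_derivative f (at x) (axis i 1)"

fun partial_derivs :: "'n::finite list \<Rightarrow> (real^'n \<Rightarrow> real) \<Rightarrow> real^'n \<Rightarrow> real" where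
  "partial_derivs [] f = f"
| "partial_derivs (i # is) f = partial_deriv i (partial_derivs is f)"

definition smooth :: "(real^'n::finite \<Rightarrow> real) \<Rightarrow> bool" where
  "smooth f \<longleftrightarrow> (\<forall>is x. partial_derivs is f differentiable (at x))"

text \<open>\<open>C\<^sub>c\<^sup>\<infinity>(D)\<close>, as functions on the whole space with support in \<open>D\<close>.\<close>

definition test_functions :: "(real^'n::finite) set \<Rightarrow> (real^'n \<Rightarrow> real) set" where
  "test_functions D =
     {\<psi>. smooth \<psi> \<and> compact (closure {x. \<psi> x \<noteq> 0}) \<and> closure {x. \<psi> x \<noteq> 0} \<subseteq> D}"

definition locally_integrable :: "(real^'n::finite) set \<Rightarrow> (real^'n \<Rightarrow> real) \<Rightarrow> bool" where
  "locally_integrable D f \<longleftrightarrow> (\<forall>K. compact K \<and> K \<subseteq> D \<longrightarrow> set_integrable lebesgue K f)"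

definition weak_deriv ::
    "(real^'n::finite) set \<Rightarrow> 'n list \<Rightarrow> (real^'n \<Rightarrow> real) \<Rightarrow> (real^'n \<Rightarrow> real) \<Rightarrow> bool" where
  "weak_deriv D is f g \<longleftrightarrow>
     locally_integrable D f \<and> locally_integrable D g \<and>
     (\<forall>\<psi>\<in>test_functions D.
        (LINT x:D|lebesgue. f x * partial_derivs is \<psi> x) =
        (-1) ^ length is * (LINT x:D|lebesgue. g x * \<psi> x))"

definition Lp :: "real \<Rightarrow> (real^'n::finite) set \<Rightarrow> (real^'n \<Rightarrow> real) set" where
  "Lp p D = {f. set_borel_measurable lebesgue D f \<and> set_integrable lebesgue D (\<lambda>x. \<bar>f x\<bar> powr p)}"

definition sobolev :: "nat \<Rightarrow> real \<Rightarrow> (real^'n::finite) set \<Rightarrow> (real^'n \<Rightarrow> real) set" where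
  "sobolev k p D = {f. f \<in> Lp p D \<and> (\<forall>is. length is \<le> k \<longrightarrow> (\<exists>g\<in>Lp p D. weak_deriv D is f g))}"

definition weak_hessian ::
    "(real^'n::finite) set \<Rightarrow> (real^'n \<Rightarrow> real) \<Rightarrow> (real^'n \<Rightarrow> real^'n^'n) \<Rightarrow> bool" where
  "weak_hessian D f H \<longleftrightarrow> (\<forall>i j. weak_deriv D [i, j] f (\<lambda>x. H x $ i $ j))"

definition eigenspace :: "real^'n^'n::finite \<Rightarrow> real \<Rightarrow> (real^'n) set" where
  "eigenspace M t = {v. M *v v = t *\<^sub>R v}"

definition eigenvalues :: "real^'n^'n::finite \<Rightarrow> real set" where
  "eigenvalues M = {t. \<exists>v\<in>eigenspace M t. v \<noteq> 0}"

text \<open>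
  The sums over eigenvalues count multiplicity, which for a symmetric matrix is the dimension of
  the eigenspace.  The operator is meant for symmetric matrices only; a weak Hessian is symmetric
  almost everywhere, so other arguments do not influence the essential limits below.
\<close>

definition pucci_minus :: "real \<Rightarrow> real \<Rightarrow> real^'n^'n::finite \<Rightarrow> real" where
  "pucci_minus lam Lam M =
     lam * (\<Sum>t\<in>{t\<in>eigenvalues M. t > 0}. real (dim (eigenspace M t)) * t) +
     Lam * (\<Sum>t\<in>{t\<in>eigenvalues M. t < 0}. real (dim (eigenspace M t)) * t)"

text \<open>
  \<open>Liminf (ae_filter M)\<close> is the essential infimum over \<open>M\<close> (cf. \<open>esssup\<close> in
  \<open>HOL-Probability\<close>).  It increases as the ball shrinks, so the supremum over \<open>r\<close> is the limit
  as \<open>r\<close> tends to \<open>0\<close>.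
\<close>

definition ess_liminf :: "(real^'n::finite) set \<Rightarrow> real^'n \<Rightarrow> (real^'n \<Rightarrow> real) \<Rightarrow> ereal" where
  "ess_liminf D x f =
     (SUP r\<in>{0<..}. Liminf (ae_filter (lebesgue_on (ball x r \<inter> D))) (\<lambda>y. ereal (f y)))"

text \<open>
  The class \<open>S(\<lambda>,\<Lambda>,0)\<close> with overline: \<open>L\<^sup>n\<close>-viscosity supersolutions on an open set \<open>D\<close>.
  Elements of \<open>W\<^sup>2\<^sup>,\<^sup>n\<close> are classes modulo null sets; evaluating \<open>u - \<phi>\<close> at a point refers to the
  continuous representative, hence the continuity requirement on \<open>\<phi>\<close>.
\<close>

definition pucci_supersolution ::
    "real \<Rightarrow> real \<Rightarrow> (real^'n::finite) set \<Rightarrow> (real^'n \<Rightarrow> real) \<Rightarrow> bool" where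
  "pucci_supersolution lam Lam D u \<longleftrightarrow>
     continuous_on D u \<and>
     (\<forall>\<phi> H x. \<phi> \<in> sobolev 2 (real CARD('n)) D \<and> continuous_on D \<phi> \<and> weak_hessian D \<phi> H \<and>
        x \<in> D \<and> (\<forall>\<^sub>F y in at x within D. u x - \<phi> x \<le> u y - \<phi> y)
        \<longrightarrow> ess_liminf D x (\<lambda>y. pucci_minus lam Lam (H y)) \<le> 0)"

end

theory Submission
  imports Defs
begin

text \<open>
  All barriers are quadratic. For a unit vector \<open>e\<close>, with \<open>s\<close> the coordinate along \<open>e\<close> and \<open>t\<close> the
  distance from the axis, \<open>k s + \<beta> (M s\<^sup>2 - t\<^sup>2)\<close> has constant Hessian with one eigenvalue \<open>2\<beta>M\<close>
  and all others \<open>-2\<beta>\<close>, so it is a strict subsolution once \<open>M \<lambda> > n \<Lambda>\<close> and cannot touch \<open>u\<close> from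
  below. Choosing \<open>e\<close> freely, this carries a lower bound from a ball to a larger concentric ball,
  hence along chains of balls to any compact part of a connected region.

  Near the boundary point only \<open>e = e\<^sub>n\<close> is needed. Put \<open>R\<^sub>k = R / 2\<^sup>k\<close> and let \<open>g\<^sub>k\<close> be slightly above
  \<open>\<omega>(R\<^sub>k)\<close>. If \<open>u \<ge> a (x\<^sub>n - g\<^sub>k R\<^sub>k)\<close> at the scale \<open>R\<^sub>k\<^sub>+\<^sub>1\<close>, comparison above the flat piece
  \<open>x\<^sub>n = g\<^sub>k\<^sub>+\<^sub>1 R\<^sub>k\<^sub>+\<^sub>1\<close> gives the same bound at the next scale, with \<open>a\<close> multiplied by \<open>1 - C g\<^sub>k\<close>. The
  Dini condition makes \<open>\<Sum> g\<^sub>k\<close> converge, so the slopes stay bounded below, while the error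
  \<open>g\<^sub>k R\<^sub>k\<close> is eventually small against \<open>l\<^sub>n r\<close> on the ray through \<open>l\<close>.
\<close>

section \<open>Pucci operator and integration by parts\<close>

text \<open>Here \<open>H\<close> is 2\<beta> ((M+1) e e^T - I): an eigenvector is either orthogonal
  to \<open>e\<close>, with value -2\<beta>, or parallel to it, with value 2\<beta>M. Bounding the
  dimension of the negative eigenspace by n gives the lower bound 2\<beta> (M lam - n Lam) >
  0.\<close>

lemma pucci_minus_axial_pos:
  fixes e :: "real^'n::finite" and H :: "real^'n^'n"
  assumes e: "norm e = 1" and \<beta>: "\<beta> > 0" and lam: "lam > 0" "Lam \<ge> 0"
    and M: "M * lam > Lam * real CARD('n)"
    and H: "\<And>v. H *v v = (2 * \<beta> * (M + 1) * (e \<bullet> v)) *\<^sub>R e - (2 * \<beta>) *\<^sub>R v"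
  shows "pucci_minus lam Lam H > 0"
proof -
  have Mpos: "M > 0"
    using M lam mult_nonneg_nonneg[of Lam "real CARD('n)"]
    by (metis less_le_trans not_less of_nat_0_le_iff order_less_imp_not_less zero_less_mult_iff)
  have ee: "e \<bullet> e = 1" using e by (simp add: dot_square_norm)
  have ev: "t = 2 * \<beta> * M \<or> t = - 2 * \<beta>" if "t \<in> eigenvalues H" for t
  proof -
    from that obtain v where v: "H *v v = t *\<^sub>R v" "v \<noteq> 0"
      unfolding eigenvalues_def eigenspace_def by auto
    \<comment> \<open>If \<open>v\<close> is orthogonal to \<open>e\<close> this forces t =
      -2\<beta>; otherwise pairing with \<open>e\<close> and cancelling gives t = 2\<beta>M.\<close>
    have eq: "(2 * \<beta> * (M + 1) * (e \<bullet> v)) *\<^sub>R e = (t + 2 * \<beta>) *\<^sub>R v"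
      using v H[of v] by (simp add: algebra_simps)
    show ?thesis
    proof (cases "e \<bullet> v = 0")
      case True
      then show ?thesis using eq v by auto
    next
      case False
      have "2 * \<beta> * (M + 1) * (e \<bullet> v) = (t + 2 * \<beta>) * (e \<bullet> v)"
        using arg_cong[OF eq, of "\<lambda>w. e \<bullet> w"] ee by simp
      then show ?thesis using False by (simp add: algebra_simps)
    qed
  qed
  have e_in: "e \<in> eigenspace H (2 * \<beta> * M)"
    unfolding eigenspace_def using H[of e] ee by (simp add: algebra_simps)
  have e0: "e \<noteq> 0" using e by auto
  have dim1: "dim (eigenspace H (2 * \<beta> * M)) \<ge> 1"
    using e_in e0 by (metis dim_eq_0 in_mono less_one linorder_not_le singletonD)
  have "{t \<in> eigenvalues H. t > 0} = {2 * \<beta> * M}"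
    using ev e_in e0 \<beta> Mpos by (force simp: eigenvalues_def)
  then have pos: "(\<Sum>t\<in>{t\<in>eigenvalues H. t > 0}. real (dim (eigenspace H t)) * t) \<ge> 2 * \<beta> * M"
    using dim1 \<beta> Mpos by simp
  have "{t \<in> eigenvalues H. t < 0} \<subseteq> {- 2 * \<beta>}"
    using ev \<beta> Mpos by (force simp: mult_less_0_iff)
  \<comment> \<open>The negative part is empty in dimension 1, where every vector is a multiple of
    \<open>e\<close>.\<close>
  then consider "{t \<in> eigenvalues H. t < 0} = {}" | "{t \<in> eigenvalues H. t < 0} = {- 2 * \<beta>}"
    by blast
  then have neg: "(\<Sum>t\<in>{t\<in>eigenvalues H. t < 0}. real (dim (eigenspace H t)) * t) \<ge> - 2 * \<beta> * CARD('n)"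
  proof cases
    case 2
    have "real (dim (eigenspace H (- 2 * \<beta>))) \<le> CARD('n)"
      using dim_subset_UNIV[of "eigenspace H (- 2 * \<beta>)"] by simp
    then show ?thesis using 2 \<beta> by simp
  next
    case 1
    then show ?thesis using \<beta> by (simp only: sum.empty) simp
  qed
  have "pucci_minus lam Lam H \<ge> lam * (2 * \<beta> * M) + Lam * (- 2 * \<beta> * CARD('n))"
    unfolding pucci_minus_def using pos neg lam by (intro add_mono mult_left_mono) auto
  also have "lam * (2 * \<beta> * M) + Lam * (- 2 * \<beta> * CARD('n)) = 2 * \<beta> * (M * lam - Lam * CARD('n))"
    by (simp add: algebra_simps)
  finally show ?thesis
    using M mult_pos_pos[of "2 * \<beta>" "M * lam - Lam * CARD('n)"] \<beta> by linarith
qed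

text \<open>The ball of radius 1 already realises the bound in the supremum. Applied to a barrier,
  whose Hessian is constant, it contradicts the supersolution inequality.\<close>

lemma ess_liminf_const_ge: "ereal c \<le> ess_liminf D x (\<lambda>y. c)"
  unfolding ess_liminf_def
  by (rule SUP_upper2[of 1]) (simp, rule Liminf_bounded, simp)

section \<open>Integration by parts and classical derivatives as weak derivatives\<close>

lemma integrable_translate:
  fixes g :: "'a::euclidean_space \<Rightarrow> real"
  assumes "integrable lborel g"
  shows "integrable lborel (\<lambda>x. g (a + x))" "(LINT x|lborel. g (a + x)) = integral\<^sup>L lborel g"
proof -
  have m: "(+) a \<in> borel_measurable lborel" by (auto intro!: borel_measurable_continuous_onI continuous_intros)
  have gm: "g \<in> borel_measurable borel" using borel_measurable_integrable[OF assms] by simp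
  show "integrable lborel (\<lambda>x. g (a + x))"
    using assms integrable_distr_eq[OF m gm] by (simp add: lborel_distr_plus)
  show "(LINT x|lborel. g (a + x)) = integral\<^sup>L lborel g"
    using integral_distr[OF m gm] by (simp add: lborel_distr_plus)
qed

lemma integrable_continuous_support:
  fixes g :: "'a::euclidean_space \<Rightarrow> real"
  assumes "continuous_on UNIV g" "compact S" "\<And>x. x \<notin> S \<Longrightarrow> g x = 0"
  shows "integrable lborel g"
proof -
  have "integrable lborel (\<lambda>x. indicator S x *\<^sub>R g x)"
    using assms by (intro borel_integrable_compact) (auto intro: continuous_on_subset)
  moreover have "(\<lambda>x. indicator S x *\<^sub>R g x) = g"
    by (rule ext) (use assms(3) in \<open>auto simp: indicator_def\<close>)
  ultimately show ?thesis by simp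
qed

text \<open>Difference quotients have integral 0 by translation invariance; pass to the limit.\<close>

lemma integral_directional_derivative_zero:
  fixes g :: "'a::euclidean_space \<Rightarrow> real"
  assumes der: "\<And>x. (g has_derivative G x) (at x)" and cont: "continuous_on UNIV (\<lambda>x. G x e)"
    and e: "norm e = 1" and supp: "\<And>x. x \<notin> cball 0 R \<Longrightarrow> g x = 0"
  shows "(LINT x|lborel. G x e) = 0"
proof -
  have gcont: "continuous_on UNIV g"
    using der by (meson UNIV_I continuous_at_imp_continuous_on has_derivative_continuous)
  have gint: "integrable lborel g"
    by (rule integrable_continuous_support[OF gcont compact_cball supp])
  define h where "h k = 1 / real (Suc k)" for k
  have hpos: "h k > 0" and hle: "h k \<le> 1" for k unfolding h_def by auto
  define q where "q k x = (g (h k *\<^sub>R e + x) - g x) / h k" for k x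
  have qint: "integral\<^sup>L lborel (q k) = 0" for k
    unfolding q_def using integrable_translate[OF gint] gint by simp
  have "bounded ((\<lambda>x. G x e) ` cball 0 (R+2))"
    by (intro compact_imp_bounded compact_continuous_image compact_cball)
       (use cont continuous_on_subset in blast)
  then obtain B where B: "B > 0" "\<And>x. x \<in> cball 0 (R+2) \<Longrightarrow> \<bar>G x e\<bar> \<le> B"
    by (metis bounded_pos imageI real_norm_def)
  have line: "((\<lambda>t. g (t *\<^sub>R e + x)) has_real_derivative G (t *\<^sub>R e + x) e) (at t)" for t x
  proof -
    have "((\<lambda>t. g (t *\<^sub>R e + x)) has_derivative (\<lambda>s. G (t *\<^sub>R e + x) (s *\<^sub>R e))) (at t)"
      by (rule has_derivative_compose[OF _ der]) (auto intro!: derivative_eq_intros)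
    moreover have "G y (s *\<^sub>R e) = G y e * s" for y s
      using has_derivative_linear[OF der, of y] by (simp add: linear_cmul)
    ultimately show ?thesis by (simp add: has_field_derivative_def)
  qed
  \<comment> \<open>Domination: the mean value theorem bounds the quotient by the supremum of the
    derivative on the ball of radius R + 2, and since h k \<le> 1 both terms vanish outside the ball
    of radius R + 1.\<close>
  have bnd: "norm (q k x) \<le> indicator (cball 0 (R+1)) x *\<^sub>R B" for k x
  proof (cases "x \<in> cball 0 (R+1)")
    case True
    obtain z where z: "z > 0" "z < h k" "g (h k *\<^sub>R e + x) - g (0 *\<^sub>R e + x) = (h k - 0) * G (z *\<^sub>R e + x) e"
      using MVT2[OF hpos[of k], of "\<lambda>t. g (t *\<^sub>R e + x)" "\<lambda>t. G (t *\<^sub>R e + x) e"] line by metis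
    have "norm (z *\<^sub>R e + x) \<le> R + 2"
      using norm_triangle_ineq[of "z *\<^sub>R e" x] z e True hle[of k] by simp
    then show ?thesis using B(2)[of "z *\<^sub>R e + x"] z(3) hpos[of k] True by (simp add: q_def)
  next
    case False
    have "norm x \<le> norm (h k *\<^sub>R e + x) + norm (h k *\<^sub>R e)"
      by (metis add_diff_cancel_left' norm_triangle_ineq4 add.commute)
    then have "norm (h k *\<^sub>R e + x) > R" "norm x > R"
      using False hpos[of k] hle[of k] e by auto
    then have "g (h k *\<^sub>R e + x) = 0" "g x = 0" by (auto intro!: supp)
    then show ?thesis using False by (simp add: q_def)
  qed
  have h0: "h \<longlonglongrightarrow> 0" unfolding h_def using LIMSEQ_inverse_real_of_nat by (simp add: inverse_eq_divide)
  have lim: "(\<lambda>k. q k x) \<longlonglongrightarrow> G x e" for x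
  proof -
    have "((\<lambda>s. (g (s *\<^sub>R e + x) - g x) / s) \<longlongrightarrow> G x e) (at 0)"
      using line[of x 0] by (simp add: DERIV_def)
    moreover have "filterlim h (at 0) sequentially"
      using h0 hpos by (simp add: filterlim_at eventually_sequentially) (metis less_irrefl)
    ultimately show ?thesis unfolding q_def by (rule filterlim_compose)
  qed
  have "(\<lambda>k. integral\<^sup>L lborel (q k)) \<longlonglongrightarrow> (LINT x|lborel. G x e)"
  proof (rule integral_dominated_convergence[where w = "\<lambda>x. indicator (cball 0 (R+1)) x *\<^sub>R B"])
    show "(\<lambda>x. G x e) \<in> borel_measurable lborel"
      using cont borel_measurable_continuous_onI by auto
    show "q k \<in> borel_measurable lborel" for k
    proof -
      have "continuous_on UNIV (\<lambda>x. g (h k *\<^sub>R e + x))"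
        by (rule continuous_on_compose2[OF gcont]) (auto intro!: continuous_intros)
      then have "continuous_on UNIV (q k)"
        unfolding q_def using hpos[of k] gcont by (intro continuous_intros) auto
      then show ?thesis using borel_measurable_continuous_onI by auto
    qed
    show "integrable lborel (\<lambda>x. indicator (cball 0 (R+1)) x *\<^sub>R B)"
      by (intro borel_integrable_compact) auto
  qed (use lim bnd in auto)
  then show ?thesis using qint by (simp add: LIMSEQ_const_iff)
qed

lemma set_integrable_continuous_bounded:
  fixes f :: "'a::euclidean_space \<Rightarrow> real"
  assumes "continuous_on UNIV f" "bounded S" "S \<in> sets lebesgue"
  shows "set_integrable lebesgue S f"
proof -
  obtain r where r: "S \<subseteq> cball 0 r" using assms(2) by (auto simp: bounded_iff subset_eq)
  have 1: "integrable lborel (\<lambda>x. indicator (cball 0 r) x *\<^sub>R f x)"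
    by (rule borel_integrable_compact[OF compact_cball continuous_on_subset[OF assms(1)]]) simp
  have 2: "set_integrable lebesgue (cball 0 r) f"
    unfolding set_integrable_def using integrable_completion[OF borel_measurable_integrable[OF 1]] 1 by blast
  show ?thesis by (rule set_integrable_subset[OF 2 assms(3) r])
qed

lemma locally_integrable_continuous:
  assumes "continuous_on UNIV f"
  shows "locally_integrable D f"
  unfolding locally_integrable_def
proof (intro allI impI)
  fix K assume K: "compact K \<and> K \<subseteq> D"
  show "set_integrable lebesgue K f"
    by (rule set_integrable_continuous_bounded[OF assms])
      (use K in \<open>simp_all add: compact_imp_bounded fmeasurableD[OF lmeasurable_compact]\<close>)
qed

lemma Lp_continuous:
  assumes "continuous_on UNIV f" "bounded D" "open D" "p > 0"
  shows "f \<in> Lp p D"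
proof -
  have D: "D \<in> sets lebesgue" using assms(3) by (simp add: borel_open)
  have "continuous_on UNIV (\<lambda>x. \<bar>f x\<bar> powr p)"
    using assms(1,4) by (intro continuous_on_powr') (auto intro!: continuous_intros)
  then have "set_integrable lebesgue D (\<lambda>x. \<bar>f x\<bar> powr p)" "set_integrable lebesgue D f"
    using set_integrable_continuous_bounded[OF _ assms(2) D] assms(1) by blast+
  moreover from this(2) have "set_borel_measurable lebesgue D f"
    unfolding set_borel_measurable_def set_integrable_def by (rule borel_measurable_integrable)
  ultimately show ?thesis unfolding Lp_def by blast
qed

lemma partial_derivs_append: "partial_derivs (is @ js) f = partial_derivs is (partial_derivs js f)"
  by (induction "is") (simp_all only: append_Nil append_Cons partial_derivs.simps)

lemma smooth_has_derivative:
  assumes "smooth f"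
  shows "(f has_derivative frechet_derivative f (at x)) (at x)"
proof -
  have "partial_derivs [] f differentiable (at x)" using assms unfolding smooth_def by blast
  then show ?thesis unfolding partial_derivs.simps frechet_derivative_works .
qed

lemma smooth_partial_deriv: "smooth f \<Longrightarrow> smooth (partial_deriv i f)"
  unfolding smooth_def
proof (intro allI)
  fix "is" x assume "\<forall>is x. partial_derivs is f differentiable at x"
  then have "partial_derivs (is @ [i]) f differentiable at x" by blast
  then show "partial_derivs is (partial_deriv i f) differentiable at x"
    by (simp only: partial_derivs_append partial_derivs.simps)
qed

lemma smooth_continuous: "smooth f \<Longrightarrow> continuous_on UNIV f"
  by (intro continuous_at_imp_continuous_on ballI has_derivative_continuous[OF smooth_has_derivative])

text \<open>The complement of the support is open, so \<open>f\<close> vanishes near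
  \<open>x\<close>.\<close>

lemma partial_deriv_eq_zero:
  assumes "x \<notin> closure {x. f x \<noteq> 0}"
  shows "partial_deriv i f x = 0"
proof -
  have "(f has_derivative (\<lambda>_. 0)) (at x)"
  proof (rule has_derivative_transform_within_open[of "\<lambda>_. 0"])
    show "open (- closure {x. f x \<noteq> 0})" by auto
    show "0 = f y" if "y \<in> - closure {x. f x \<noteq> 0}" for y
      using that closure_subset[of "{x. f x \<noteq> 0}"] by auto
  qed (use assms in auto)
  then have "(\<lambda>_. 0) = frechet_derivative f (at x)" by (rule frechet_derivative_at)
  then show ?thesis unfolding partial_deriv_def by (simp add: fun_eq_iff)
qed

lemma test_functions_partial_deriv:
  assumes "\<psi> \<in> test_functions D"
  shows "partial_deriv i \<psi> \<in> test_functions D"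
proof -
  have sub: "closure {x. partial_deriv i \<psi> x \<noteq> 0} \<subseteq> closure {x. \<psi> x \<noteq> 0}"
    using partial_deriv_eq_zero[of _ \<psi> i] by (intro closure_minimal) blast+
  have \<psi>: "smooth \<psi>" "compact (closure {x. \<psi> x \<noteq> 0})" "closure {x. \<psi> x \<noteq> 0} \<subseteq> D"
    using assms unfolding test_functions_def by auto
  have "compact (closure {x. partial_deriv i \<psi> x \<noteq> 0})"
    using compact_Int_closed[OF \<psi>(2) closed_closure] sub by (metis inf.absorb2)
  then show ?thesis
    using \<psi> sub smooth_partial_deriv[OF \<psi>(1)] unfolding test_functions_def by blast
qed

text \<open>Passes from the integrals over \<open>D\<close> in the definition of weak derivatives to
  Borel integrals over the whole space, where translation invariance is available.\<close>

lemma set_lebesgue_integral_supported: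
  fixes g :: "'a::euclidean_space \<Rightarrow> real"
  assumes "continuous_on UNIV g" "\<And>x. x \<notin> D \<Longrightarrow> g x = 0"
  shows "(LINT x:D|lebesgue. g x) = integral\<^sup>L lborel g"
proof -
  have eq: "(\<lambda>x. indicator D x *\<^sub>R g x) = g"
    by (rule ext) (use assms(2) in \<open>auto simp: indicator_def\<close>)
  have "g \<in> borel_measurable lborel"
    using borel_measurable_continuous_onI[OF assms(1)] by simp
  then show ?thesis unfolding set_lebesgue_integral_def eq by (rule integral_completion)
qed

text \<open>The product of \<open>f\<close> and \<psi> has compact support, so the integral of its
  i-th derivative is 0; the product rule splits that integral.\<close>

lemma integration_by_parts_test_function:
  fixes f f' :: "real^'n::finite \<Rightarrow> real"
  assumes der: "\<And>x. (f has_derivative F x) (at x)" and F: "\<And>x. F x (axis i 1) = f' x"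
    and cont: "continuous_on UNIV f'" and \<psi>: "\<psi> \<in> test_functions D"
  shows "(LINT x:D|lebesgue. f x * partial_deriv i \<psi> x) = - (LINT x:D|lebesgue. f' x * \<psi> x)"
proof -
  have sm: "smooth \<psi>" and cpt: "compact (closure {x. \<psi> x \<noteq> 0})" and sub: "closure {x. \<psi> x \<noteq> 0} \<subseteq> D"
    using \<psi> unfolding test_functions_def by auto
  let ?S = "closure {x. \<psi> x \<noteq> 0}"
  have z: "\<psi> x = 0 \<and> partial_deriv i \<psi> x = 0" if "x \<notin> ?S" for x
    using that closure_subset[of "{x. \<psi> x \<noteq> 0}"] partial_deriv_eq_zero[of x \<psi>] by blast
  have z1: "f x * partial_deriv i \<psi> x = 0" and z2: "f' x * \<psi> x = 0" if "x \<notin> ?S" for x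
    using z[OF that] by (simp_all only: mult_zero_right)
  have fc: "continuous_on UNIV f"
    by (intro continuous_at_imp_continuous_on ballI has_derivative_continuous[OF der])
  have c1: "continuous_on UNIV (\<lambda>x. f x * partial_deriv i \<psi> x)"
    by (intro continuous_on_mult fc smooth_continuous[OF smooth_partial_deriv[OF sm]])
  have c2: "continuous_on UNIV (\<lambda>x. f' x * \<psi> x)"
    by (intro continuous_on_mult cont smooth_continuous[OF sm])
  obtain R where R: "?S \<subseteq> cball 0 R"
    using compact_imp_bounded[OF cpt] by (auto simp only: bounded_iff subset_eq mem_cball_0)
  let ?G = "\<lambda>x h. f x * frechet_derivative \<psi> (at x) h + F x h * \<psi> x"
  have "(LINT x|lborel. ?G x (axis i 1)) = 0"
  proof (rule integral_directional_derivative_zero[where g = "\<lambda>x. f x * \<psi> x" and R = R])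
    show "((\<lambda>x. f x * \<psi> x) has_derivative ?G x) (at x)" for x
      by (rule has_derivative_mult[OF der smooth_has_derivative[OF sm]])
    show "continuous_on UNIV (\<lambda>x. ?G x (axis i 1))"
      using continuous_on_add[OF c1 c2] by (simp add: F partial_deriv_def)
    show "f x * \<psi> x = 0" if "x \<notin> cball 0 R" for x
    proof -
      have "x \<notin> ?S" using that R by blast
      from z[OF this] show ?thesis by (simp only: mult_zero_right)
    qed
  qed simp
  moreover have "(LINT x|lborel. ?G x (axis i 1)) =
      (LINT x|lborel. f x * partial_deriv i \<psi> x) + (LINT x|lborel. f' x * \<psi> x)"
    unfolding F partial_deriv_def[symmetric]
    by (rule Bochner_Integration.integral_add[OF integrable_continuous_support[OF c1 cpt z1] 
          integrable_continuous_support[OF c2 cpt z2]])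
  moreover have "(LINT x:D|lebesgue. f x * partial_deriv i \<psi> x) = (LINT x|lborel. f x * partial_deriv i \<psi> x)"
    by (rule set_lebesgue_integral_supported[OF c1 z1]) (use sub in blast)
  moreover have "(LINT x:D|lebesgue. f' x * \<psi> x) = (LINT x|lborel. f' x * \<psi> x)"
    by (rule set_lebesgue_integral_supported[OF c2 z2]) (use sub in blast)
  ultimately show ?thesis by simp
qed

lemma weak_deriv_Nil:
  assumes "continuous_on UNIV f"
  shows "weak_deriv D [] f f"
  unfolding weak_deriv_def using assms by (simp add: locally_integrable_continuous)

text \<open>The head of the list is the outermost derivative on the test function, so one
  integration by parts moves it onto \<open>f\<close> and contributes the sign. Iterating yields
  higher weak derivatives from classical ones.\<close>

lemma weak_deriv_Cons:
  fixes f f' :: "real^'n::finite \<Rightarrow> real"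
  assumes der: "\<And>x. (f has_derivative F x) (at x)" and F: "\<And>x. F x (axis i 1) = f' x"
    and cont: "continuous_on UNIV f'" and w: "weak_deriv D is f' g"
  shows "weak_deriv D (i # is) f g"
  unfolding weak_deriv_def
proof (intro conjI ballI)
  show "locally_integrable D f"
    by (intro locally_integrable_continuous continuous_at_imp_continuous_on ballI
        has_derivative_continuous[OF der])
  show "locally_integrable D g" using w unfolding weak_deriv_def by blast
  fix \<psi> assume \<psi>: "\<psi> \<in> test_functions D"
  have t: "partial_derivs is \<psi> \<in> test_functions D"
    by (induction "is") (use \<psi> test_functions_partial_deriv in auto)
  have "(LINT x:D|lebesgue. f x * partial_derivs (i # is) \<psi> x) =
      - (LINT x:D|lebesgue. f' x * partial_derivs is \<psi> x)"
    using integration_by_parts_test_function[OF der F cont t] by simp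
  also have "\<dots> = (-1) ^ length (i # is) * (LINT x:D|lebesgue. g x * \<psi> x)"
    using w \<psi> unfolding weak_deriv_def by simp
  finally show "(LINT x:D|lebesgue. f x * partial_derivs (i # is) \<psi> x) =
      (-1) ^ length (i # is) * (LINT x:D|lebesgue. g x * \<psi> x)" .
qed

section \<open>Quadratic barriers and comparison\<close>

text \<open>For a unit vector \<open>e\<close> this is the orthogonal projection onto the hyperplane
  normal to \<open>e\<close>; its norm is the distance from the axis.\<close>

definition perp :: "'a::real_inner \<Rightarrow> 'a \<Rightarrow> 'a" where
  "perp e x = x - (e \<bullet> x) *\<^sub>R e"

lemma perp_linear: "perp e (x + y) = perp e x + perp e y" "perp e (x - y) = perp e x - perp e y"
  "perp e (c *\<^sub>R x) = c *\<^sub>R perp e x" "perp e 0 = 0"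
  unfolding perp_def by (simp_all add: algebra_simps)

lemma perp_self: "norm e = 1 \<Longrightarrow> perp e e = 0"
  unfolding perp_def by (simp add: norm_eq_1)

lemma norm_perp_sq:
  assumes "norm e = 1"
  shows "(norm (perp e x))\<^sup>2 = (norm x)\<^sup>2 - (e \<bullet> x)\<^sup>2"
proof -
  have "e \<bullet> e = 1" using assms by (simp add: norm_eq_1)
  then have "perp e x \<bullet> perp e x = x \<bullet> x - (e \<bullet> x)\<^sup>2"
    unfolding perp_def inner_diff_left inner_diff_right inner_scaleR_left inner_scaleR_right
      inner_commute[of x e] by algebra
  then show ?thesis by (simp only: power2_norm_eq_inner)
qed

lemma norm_perp_le:
  assumes "norm e = 1"
  shows "norm (perp e x) \<le> norm x"
proof (rule power2_le_imp_le)
  show "(norm (perp e x))\<^sup>2 \<le> (norm x)\<^sup>2" unfolding norm_perp_sq[OF assms] by simp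
qed simp

lemma continuous_on_perp: "continuous_on S (\<lambda>x. norm (perp e (x - p)))"
  unfolding perp_def by (intro continuous_intros)

text \<open>Both sides satisfy Pythagoras with the coordinate \<open>x $ N\<close>. This translates
  barriers along e_n into the |x'| of the boundary condition.\<close>

lemma norm_perp_axis: "norm (perp (axis N 1) x) = tangential_norm N x"
proof -
  have "(tangential_norm N x)\<^sup>2 = (\<Sum>i\<in>-{N}. (x $ i)\<^sup>2)"
    unfolding tangential_norm_def by (simp add: L2_set_def sum_nonneg)
  also have "\<dots> = (norm x)\<^sup>2 - (x $ N)\<^sup>2"
    by (simp add: norm_vec_def L2_set_def sum_nonneg sum.remove[of UNIV N] Compl_eq_Diff_UNIV)
  also have "\<dots> = (norm (perp (axis N 1) x))\<^sup>2"
    using norm_perp_sq[of "axis N 1" x] by (simp add: inner_axis')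
  finally show ?thesis
    using power2_eq_imp_eq[of "tangential_norm N x" "norm (perp (axis N 1) x)"]
    by (simp add: tangential_norm_def L2_set_nonneg)
qed

text \<open>The point \<open>p\<close> is the centre of the face s = 0 of the comparison cylinder,
  \<open>k\<close> the slope obtained on the axis, and \<beta> the size of the quadratic
  correction.\<close>

definition barrier :: "real^'n::finite \<Rightarrow> real^'n \<Rightarrow> real \<Rightarrow> real \<Rightarrow> real \<Rightarrow> real^'n \<Rightarrow> real" where
  "barrier e p M k \<beta> x =
     k * (e \<bullet> (x - p)) + \<beta> * (M * (e \<bullet> (x - p))\<^sup>2 - (norm (perp e (x - p)))\<^sup>2)"

lemma continuous_on_barrier: "continuous_on S (barrier e p M k \<beta>)"
  unfolding barrier_def by (intro continuous_intros continuous_on_perp)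

definition barrier_grad where
  "barrier_grad e p M k \<beta> j x =
     k * e $ j + 2 * \<beta> * ((M + 1) * (e \<bullet> (x - p)) * e $ j - (x - p) $ j)"

definition barrier_hess :: "real^'n::finite \<Rightarrow> real \<Rightarrow> real \<Rightarrow> real^'n^'n" where
  "barrier_hess e M \<beta> = (\<chi> i j. 2 * \<beta> * ((M + 1) * e $ i * e $ j - (if i = j then 1 else 0)))"

lemma barrier_has_derivative:
  assumes e: "norm e = 1"
  shows "(barrier e p M k \<beta> has_derivative
     (\<lambda>h. k * (e \<bullet> h) + 2 * \<beta> * ((M + 1) * (e \<bullet> (x - p)) * (e \<bullet> h) - (x - p) \<bullet> h))) (at x)"
proof -
  \<comment> \<open>Replacing the squared distance from the axis by |x-p|^2 - s^2 turns the
    coefficient M into M + 1 and leaves a plain inner product to differentiate.\<close>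
  have eq: "barrier e p M k \<beta> =
      (\<lambda>x. k * (e \<bullet> (x - p)) + \<beta> * ((M + 1) * (e \<bullet> (x - p))\<^sup>2 - (x - p) \<bullet> (x - p)))"
    unfolding barrier_def norm_perp_sq[OF e] by (rule ext, simp only: power2_norm_eq_inner, algebra)
  show ?thesis unfolding eq
    apply (rule derivative_eq_intros refl)+
    apply (rule ext) apply (simp only: inner_commute[of _ "x - p"] diff_0_right power_one_right one_add_one)
    by (simp add: inner_commute[of h "x - p" for h] distrib_left distrib_right right_diff_distrib left_diff_distrib)
qed

lemma barrier_grad_has_derivative:
  "(barrier_grad e p M k \<beta> j has_derivative
     (\<lambda>h. 2 * \<beta> * ((M + 1) * (e \<bullet> h) * e $ j - h $ j))) (at x)"
proof -
  have eq: "barrier_grad e p M k \<beta> j = (\<lambda>x. k * e $ j + 2 * \<beta> * ((M + 1) * (e \<bullet> (x - p)) * e $ j - (x - p) \<bullet> axis j 1))"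
    unfolding barrier_grad_def by (simp add: inner_axis)
  show ?thesis unfolding eq
    apply (rule derivative_eq_intros refl)+
    apply (rule ext) apply (simp only: inner_axis diff_0_right)
    by (simp add: algebra_simps)
qed

lemma barrier_hess_mult:
  "barrier_hess e M \<beta> *v v = (2 * \<beta> * (M + 1) * (e \<bullet> v)) *\<^sub>R e - (2 * \<beta>) *\<^sub>R v"
  unfolding vec_eq_iff
proof (rule allI)
  fix i
  have "(barrier_hess e M \<beta> *v v) $ i = (\<Sum>j\<in>UNIV. 2 * \<beta> * ((M + 1) * e $ i * (e $ j * v $ j)) - (if i = j then 2 * \<beta> * v $ j else 0))"
    unfolding matrix_vector_mult_def barrier_hess_def by (auto intro!: sum.cong simp: algebra_simps)
  also have "\<dots> = 2 * \<beta> * ((M + 1) * e $ i * (e \<bullet> v)) - 2 * \<beta> * v $ i"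
    by (simp add: sum_subtractf sum.delta' inner_vec_def sum_distrib_left)
  finally show "(barrier_hess e M \<beta> *v v) $ i = ((2 * \<beta> * (M + 1) * (e \<bullet> v)) *\<^sub>R e - (2 * \<beta>) *\<^sub>R v) $ i"
    by (simp only: vector_minus_component vector_scaleR_component real_scaleR_def mult.assoc mult.commute mult.left_commute)
qed

lemma inner_axis_1: "axis N 1 \<bullet> x = (x :: real^'n::finite) $ N"
  by (simp add: inner_axis')

lemma tangential_norm_triangle:
  "tangential_norm N (x + y) \<le> tangential_norm N x + tangential_norm N y"
  unfolding norm_perp_axis[symmetric] perp_linear by (rule norm_triangle_ineq)

lemma tangential_norm_le: "tangential_norm N x \<le> norm x"
  unfolding norm_perp_axis[symmetric] by (rule norm_perp_le) simp

lemma tangential_norm_nonneg: "0 \<le> tangential_norm N x"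
  unfolding norm_perp_axis[symmetric] by simp

lemma tangential_norm_scaleR: "tangential_norm N (c *\<^sub>R x) = \<bar>c\<bar> * tangential_norm N x"
  unfolding norm_perp_axis[symmetric] perp_linear by simp

lemma continuous_on_barrier_grad: "continuous_on S (barrier_grad e p M k \<beta> j)"
  unfolding barrier_grad_def by (intro continuous_intros)

lemma weak_deriv_barrier_grad:
  "weak_deriv D [j] (barrier_grad e p M k \<beta> i) (\<lambda>x. barrier_hess e M \<beta> $ i $ j)"
proof (rule weak_deriv_Cons[OF barrier_grad_has_derivative])
  show "2 * \<beta> * ((M + 1) * (e \<bullet> axis j 1) * e $ i - axis j 1 $ i) = barrier_hess e M \<beta> $ i $ j" for x :: "real^'a"
    unfolding barrier_hess_def by (simp add: inner_axis) (simp add: axis_def)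
qed (simp_all add: weak_deriv_Nil)

lemma weak_deriv_barrier:
  assumes e: "norm e = 1"
    and w: "weak_deriv D is (barrier_grad e p M k \<beta> i) g"
  shows "weak_deriv D (i # is) (barrier e p M k \<beta>) g"
proof (rule weak_deriv_Cons[OF barrier_has_derivative[OF e] _ continuous_on_barrier_grad w])
  show "k * (e \<bullet> axis i 1) + 2 * \<beta> * ((M + 1) * (e \<bullet> (x - p)) * (e \<bullet> axis i 1) - (x - p) \<bullet> axis i 1)
      = barrier_grad e p M k \<beta> i x" for x
    unfolding barrier_grad_def by (simp add: inner_axis)
qed

lemma barrier_weak_hessian:
  "norm e = 1 \<Longrightarrow> weak_hessian D (barrier e p M k \<beta>) (\<lambda>x. barrier_hess e M \<beta>)"
  unfolding weak_hessian_def by (intro allI weak_deriv_barrier weak_deriv_barrier_grad)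

text \<open>The barrier and its derivatives are continuous on the whole space, hence in L^q of the
  bounded set \<open>D\<close>; the lists to treat are \<open>[]\<close>, \<open>[i]\<close> and
  \<open>[i, j]\<close>.\<close>

lemma barrier_sobolev:
  fixes e p :: "real^'n::finite"
  assumes e: "norm e = 1" and D: "open D" "bounded D" and q: "q > 0"
  shows "barrier e p M k \<beta> \<in> sobolev 2 q D"
  unfolding sobolev_def
proof (intro CollectI conjI allI impI)
  show "barrier e p M k \<beta> \<in> Lp q D"
    by (rule Lp_continuous[OF continuous_on_barrier D(2,1) q])
  fix "is" :: "'n list" assume len: "length is \<le> 2"
  show "\<exists>g\<in>Lp q D. weak_deriv D is (barrier e p M k \<beta>) g"
  proof (cases "is")
    case Nil
    then show ?thesis
      using Lp_continuous[OF continuous_on_barrier D(2,1) q] weak_deriv_Nil[OF continuous_on_barrier] by blast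
  next
    case (Cons i js)
    show ?thesis
    proof (cases js)
      case Nil
      then show ?thesis
        using Lp_continuous[OF continuous_on_barrier_grad D(2,1) q] Cons
          weak_deriv_barrier[OF e weak_deriv_Nil[OF continuous_on_barrier_grad]] by blast
    next
      case (Cons j ks)
      then have "is = [i, j]" using len \<open>is = i # js\<close> by simp
      then show ?thesis
        using Lp_continuous[OF continuous_on_const D(2,1) q]
          weak_deriv_barrier[OF e weak_deriv_barrier_grad] by blast
    qed
  qed
qed

section \<open>Comparison of supersolutions with quadratic barriers\<close>

locale pucci_bounds =
  fixes lam Lam M :: real and n :: "'n::finite itself"
  assumes lam: "lam > 0" "Lam \<ge> 0" and M: "M * lam > Lam * real CARD('n)"
begin

lemma M_pos: "M > 0"
proof -
  have "M * lam > 0" using M lam mult_nonneg_nonneg[of Lam "real CARD('n)"] by linarith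
  then show ?thesis using lam by (simp add: zero_less_mult_iff)
qed

text \<open>The barrier is an admissible test function with constant positive Pucci value, whereas
  contact from below would force a value at most 0.\<close>

lemma no_barrier_contact:
  fixes e p x :: "real^'n"
  assumes "pucci_supersolution lam Lam D u" "open D" "bounded D" "norm e = 1" "\<beta> > 0" "x \<in> D"
  shows "\<not> (\<forall>\<^sub>F y in at x within D. u x - barrier e p M k \<beta> x \<le> u y - barrier e p M k \<beta> y)"
proof
  assume min: "\<forall>\<^sub>F y in at x within D. u x - barrier e p M k \<beta> x \<le> u y - barrier e p M k \<beta> y"
  let ?c = "pucci_minus lam Lam (barrier_hess e M \<beta>)"
  have "ess_liminf D x (\<lambda>y. ?c) \<le> 0"
  proof (rule conjunct2[OF assms(1)[unfolded pucci_supersolution_def], rule_format], intro conjI)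
    show "barrier e p M k \<beta> \<in> sobolev 2 (real CARD('n)) D"
      by (rule barrier_sobolev[OF assms(4,2,3)]) simp
  qed (fact continuous_on_barrier barrier_weak_hessian[OF assms(4)] assms(6) min)+
  then have "ereal ?c \<le> 0" by (rule order_trans[OF ess_liminf_const_ge])
  moreover have "?c > 0"
    by (rule pucci_minus_axial_pos[OF assms(4,5) lam M barrier_hess_mult])
  ultimately show False by simp
qed

text \<open>A negative minimum of \<open>u\<close> minus the barrier over \<open>K\<close> cannot
  occur at a boundary point of \<open>K\<close>, so it is a local minimum in \<open>D\<close>, which
  is a forbidden contact.\<close>

lemma comparison:
  fixes e p :: "real^'n"
  assumes super: "pucci_supersolution lam Lam D u" and D: "open D" "bounded D"
    and e: "norm e = 1" and \<beta>: "\<beta> > 0"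
    and K: "compact K" "K \<subseteq> D" and bd: "\<And>x. x \<in> K - interior K \<Longrightarrow> barrier e p M k \<beta> x \<le> u x"
    and x: "x \<in> K"
  shows "barrier e p M k \<beta> x \<le> u x"
proof (rule ccontr)
  let ?w = "\<lambda>y. u y - barrier e p M k \<beta> y"
  assume neg: "\<not> ?thesis"
  have "continuous_on D u" using super unfolding pucci_supersolution_def by blast
  then have "continuous_on K u" using K(2) continuous_on_subset by blast
  then have "continuous_on K ?w" by (intro continuous_on_diff continuous_on_barrier)
  then obtain z where z: "z \<in> K" "\<And>y. y \<in> K \<Longrightarrow> ?w z \<le> ?w y"
    using continuous_attains_inf[OF K(1), of ?w] x by blast
  have "?w z < 0" using z(2)[OF x] neg by simp
  then have zi: "z \<in> interior K" using bd[of z] z(1) by force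
  have "\<forall>\<^sub>F y in at z within D. y \<in> interior K"
    using zi by (intro topological_tendstoD[OF tendsto_ident_at open_interior])
  then have "\<forall>\<^sub>F y in at z within D. ?w z \<le> ?w y"
    by eventually_elim (use z(2) interior_subset in blast)
  then show False
    using no_barrier_contact[OF super D e \<beta>, of z p k] z(1) K(2) by blast
qed

text \<open>
  On \<open>s = 0\<close> the barrier is nonpositive, so there it suffices that \<open>u\<close> is nonnegative.
\<close>

lemma cylinder_comparison:
  fixes e p :: "real^'n"
  defines "Z h T \<equiv> {x. 0 \<le> e \<bullet> (x - p) \<and> e \<bullet> (x - p) \<le> h \<and> norm (perp e (x - p)) \<le> T}"
  assumes super: "pucci_supersolution lam Lam D u" and D: "open D" "bounded D"
    and e: "norm e = 1" and \<beta>: "\<beta> > 0"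
    and Z: "Z h T \<subseteq> D" and T: "T \<ge> 0"
    and nonneg: "\<And>x. x \<in> Z h T \<Longrightarrow> 0 \<le> u x"
    and side: "\<And>x. \<lbrakk>x \<in> Z h T; norm (perp e (x - p)) = T\<rbrakk> \<Longrightarrow> barrier e p M k \<beta> x \<le> u x"
    and top: "\<And>x. \<lbrakk>x \<in> Z h T; e \<bullet> (x - p) = h\<rbrakk> \<Longrightarrow> barrier e p M k \<beta> x \<le> u x"
    and s: "0 \<le> s" "s \<le> h"
  shows "k * s \<le> u (p + s *\<^sub>R e)"
proof -
  have ee: "e \<bullet> e = 1" using e by (simp add: norm_eq_1)
  let ?O = "{x. 0 < e \<bullet> (x - p) \<and> e \<bullet> (x - p) < h \<and> norm (perp e (x - p)) < T}"
  have "closed (Z h T)"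
    unfolding Z_def by (intro closed_Collect_conj closed_Collect_le continuous_intros continuous_on_perp)
  moreover have "bounded (Z h T)"
    using D(2) Z bounded_subset by blast
  ultimately have cpt: "compact (Z h T)" by (simp add: compact_eq_bounded_closed)
  have "open ?O"
    by (intro open_Collect_conj open_Collect_less continuous_intros continuous_on_perp)
  then have int: "?O \<subseteq> interior (Z h T)"
    by (intro interior_maximal) (auto simp: Z_def)
  have bd: "barrier e p M k \<beta> x \<le> u x" if x: "x \<in> Z h T - interior (Z h T)" for x
  proof -
    have xZ: "x \<in> Z h T" and "x \<notin> ?O" using x int by blast+
    then consider "e \<bullet> (x - p) = 0" | "e \<bullet> (x - p) = h" | "norm (perp e (x - p)) = T"
      unfolding Z_def by force
    then show ?thesis
    proof cases
      case 1
      then have "barrier e p M k \<beta> x \<le> 0" unfolding barrier_def using \<beta> by (simp add: zero_le_mult_iff)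
      then show ?thesis using nonneg[OF xZ] by linarith
    qed (use side top xZ in blast)+
  qed
  have mem: "p + s *\<^sub>R e \<in> Z h T"
    unfolding Z_def using s T ee by (simp add: perp_linear perp_self[OF e])
  have "barrier e p M k \<beta> (p + s *\<^sub>R e) = k * s + \<beta> * (M * s\<^sup>2)"
    unfolding barrier_def using ee by (simp add: perp_linear perp_self[OF e])
  then have "k * s \<le> barrier e p M k \<beta> (p + s *\<^sub>R e)" using \<beta> M_pos by simp
  also have "\<dots> \<le> u (p + s *\<^sub>R e)"
    by (rule comparison[OF super D e \<beta> cpt Z bd mem])
  finally show ?thesis .
qed

section \<open>Propagation of lower bounds\<close>

text \<open>Boundedness of \<open>D\<close> is what places the quadratic barriers in
  W^{2,n}(D).\<close>

definition admissible :: "(real^'n) set \<Rightarrow> (real^'n \<Rightarrow> real) \<Rightarrow> bool" where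
  "admissible D u \<longleftrightarrow> open D \<and> bounded D \<and> pucci_supersolution lam Lam D u \<and> (\<forall>x\<in>D. 0 \<le> u x)"

text \<open>The factor by which one barrier step enlarges a radius \<rho>: the gain is half of the
  height h = 2\<rho> / (16M + 9).\<close>

definition growth :: real where
  "growth = 1 + 1 / (16 * M + 9)"

lemma growth_gt_1: "growth > 1"
  unfolding growth_def using M_pos by simp

text \<open>
  With \<open>h = 2\<rho> / (16M + 9)\<close>, the set where \<open>\<rho>s + Ms\<^sup>2 - t\<^sup>2 > 0\<close> and \<open>0 < s < 4h\<close> leaves the
  ball of radius \<open>\<rho>\<close> only through its side \<open>s = 0\<close>, placed at distance \<open>h\<close> outside the ball.
\<close>

lemma ball_step:
  fixes y :: "real^'n"
  assumes \<rho>: "\<rho> > 0" and adm: "admissible D u" and sub: "cball y (2 * \<rho>) \<subseteq> D" and m: "m \<ge> 0"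
    and low: "\<And>x. x \<in> cball y \<rho> \<Longrightarrow> m \<le> u x" and x: "x \<in> cball y (growth * \<rho>)"
  shows "m / 12 \<le> u x"
proof -
  note M0 = M_pos
  have D: "open D" "bounded D" "pucci_supersolution lam Lam D u" "\<And>x. x \<in> D \<Longrightarrow> 0 \<le> u x"
    using adm unfolding admissible_def by blast+
  define h where "h = 2 * (\<rho> / (16 * M + 9))"
  have h0: "h > 0" unfolding h_def using \<rho> M0 by simp
  have hM: "(16 * M + 9) * h = 2 * \<rho>" unfolding h_def using M0 by simp
  have Mh: "16 * M * h = 2 * \<rho> - 9 * h" using hM by (simp add: algebra_simps)
  have "M * h > 0" using M0 h0 by simp
  then have h9: "9 * h \<le> 2 * \<rho>" using Mh by linarith
  have gr: "growth * \<rho> = \<rho> + h / 2" unfolding growth_def h_def distrib_right by (simp only: mult_1_left times_divide_eq_left nonzero_mult_div_cancel_left[of 2] zero_neq_numeral[symmetric] simp_thms)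
  have dx: "dist y x \<le> \<rho> + h / 2" using x gr by simp
  consider "dist y x \<le> \<rho>" | "m = 0" | "dist y x > \<rho>" "m > 0" using m by linarith
  then show ?thesis
  proof cases
    case 1
    then have "m \<le> u x" using low by simp
    then show ?thesis using m by linarith
  next
    case 2
    have "dist y x \<le> 2 * \<rho>" using dx h9 h0 by linarith
    then have "x \<in> D" using sub by auto
    then show ?thesis using 2 D(4) by simp
  next
    case 3
    define d where "d = norm (y - x)"
    have d: "d > \<rho>" "d \<le> \<rho> + h / 2" using 3 dx unfolding d_def by (simp_all add: dist_norm)
    define e where "e = (1 / d) *\<^sub>R (y - x)"
    have e: "norm e = 1" unfolding e_def using d \<rho> by (simp add: d_def[symmetric])
    have ee: "e \<bullet> e = 1" using e by (simp add: norm_eq_1)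
    have de: "d *\<^sub>R e = y - x" unfolding e_def using d \<rho> by simp
    \<comment> \<open>The axis runs from \<open>p\<close>, at distance \<open>h\<close> outside the
      ball, through \<open>x\<close> to the centre \<open>y\<close>. The height of \<open>x\<close>
      above \<open>p\<close> is \<rho> + h - d, which lies between h/2 and h.\<close>
    define p where "p = y - (\<rho> + h) *\<^sub>R e"
    \<comment> \<open>This is the value of \<rho>s + Ms^2 at s = 4h. With the choice of
      \<open>h\<close> it equals 6\<rho>h - 9h^2, so the rim s = 4h, t^2 = T2 lies exactly on the
      sphere of radius \<rho> about \<open>y\<close>.\<close>
    define T2 where "T2 = 4 * \<rho> * h + 16 * M * h\<^sup>2"
    have T2_eq: "T2 = 6 * \<rho> * h - 9 * h\<^sup>2"
      unfolding T2_def using arg_cong[OF Mh, of "\<lambda>z. z * h"] by (simp add: power2_eq_square algebra_simps)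
    have rh: "\<rho> * h > 0" "h\<^sup>2 > 0" using \<rho> h0 by auto
    have T2pos: "T2 > 0" unfolding T2_def using rh M0 by (simp add: add_pos_pos)
    \<comment> \<open>Normalised so that the barrier is at most \<open>m\<close> on the top face,
      where the bound on the ball applies.\<close>
    define \<beta> where "\<beta> = m / T2"
    have \<beta>: "\<beta> > 0" unfolding \<beta>_def using 3 T2pos by simp
    have dist_sq: "(dist y z)\<^sup>2 = (e \<bullet> (z - p) - (\<rho> + h))\<^sup>2 + (norm (perp e (z - p)))\<^sup>2" for z
    proof -
      have zy: "z - y = (z - p) - (\<rho> + h) *\<^sub>R e" unfolding p_def by simp
      have "perp e (z - y) = perp e (z - p)" unfolding zy by (simp only: perp_linear perp_self[OF e]) simp
      moreover have "e \<bullet> (z - y) = e \<bullet> (z - p) - (\<rho> + h)"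
        unfolding zy using ee by (simp only: inner_diff_right inner_scaleR_right mult_1_right)
      moreover have "dist y z = norm (z - y)" by (simp add: dist_norm norm_minus_commute)
      ultimately show ?thesis using norm_perp_sq[OF e, of "z - y"] by simp
    qed
    have bar: "barrier e p M (\<beta> * \<rho>) \<beta> z =
        \<beta> * (\<rho> * (e \<bullet> (z - p)) + M * (e \<bullet> (z - p))\<^sup>2 - (norm (perp e (z - p)))\<^sup>2)" for z
      unfolding barrier_def by (simp add: algebra_simps)
    let ?Z = "{z. 0 \<le> e \<bullet> (z - p) \<and> e \<bullet> (z - p) \<le> 4 * h \<and> norm (perp e (z - p)) \<le> sqrt T2}"
    have ZD: "?Z \<subseteq> D"
    proof
      fix z assume z: "z \<in> ?Z"
      have t: "(norm (perp e (z - p)))\<^sup>2 \<le> T2" using z sqrt_ge_absD[of "norm (perp e (z - p))" T2] by simp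
      have "\<bar>e \<bullet> (z - p) - (\<rho> + h)\<bar> \<le> \<rho> + h" using z h9 h0 by auto
      then have "(e \<bullet> (z - p) - (\<rho> + h))\<^sup>2 \<le> (\<rho> + h)\<^sup>2" using abs_le_square_iff[of _ "\<rho> + h"] \<rho> h0 by simp
      then have "(dist y z)\<^sup>2 \<le> (\<rho> + h)\<^sup>2 + T2" using dist_sq[of z] t by linarith
      also have "\<dots> = \<rho>\<^sup>2 + 8 * (\<rho> * h) - 8 * h\<^sup>2" unfolding T2_eq by (simp add: power2_eq_square algebra_simps)
      also have "\<dots> \<le> (2 * \<rho>)\<^sup>2"
      proof -
        have "8 * h \<le> 3 * \<rho>" using h9 \<rho> by linarith
        then have "\<rho> * (8 * h) \<le> \<rho> * (3 * \<rho>)" using \<rho> by (intro mult_left_mono) auto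
        then show ?thesis using rh by (simp add: power2_eq_square)
      qed
      finally have "dist y z \<le> 2 * \<rho>" using \<rho> by (intro power2_le_imp_le[of "dist y z"]) auto
      then show "z \<in> D" using sub by auto
    qed
    have "\<beta> * \<rho> * (\<rho> + h - d) \<le> u (p + (\<rho> + h - d) *\<^sub>R e)"
    proof (rule cylinder_comparison[OF D(3,1,2) e \<beta> ZD])
      show "0 \<le> sqrt T2" using T2pos by simp
      show "0 \<le> u z" if "z \<in> ?Z" for z using D(4) that ZD by blast
      show "0 \<le> \<rho> + h - d" "\<rho> + h - d \<le> 4 * h" using d h0 by auto
      show "barrier e p M (\<beta> * \<rho>) \<beta> z \<le> u z"
        if z: "z \<in> ?Z" and t: "norm (perp e (z - p)) = sqrt T2" for z
      proof -
        let ?s = "e \<bullet> (z - p)"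
        have s: "0 \<le> ?s" "?s \<le> 4 * h" using z by auto
        have "M * ?s\<^sup>2 \<le> M * (4 * h)\<^sup>2" using s M0 by (intro mult_left_mono power_mono) auto
        moreover have "\<rho> * ?s \<le> \<rho> * (4 * h)" using s \<rho> by (intro mult_left_mono) auto
        ultimately have "\<rho> * ?s + M * ?s\<^sup>2 \<le> T2" unfolding T2_def by (simp add: power2_eq_square)
        then have "barrier e p M (\<beta> * \<rho>) \<beta> z \<le> 0"
          unfolding bar t using \<beta> T2pos by (simp add: mult_nonneg_nonpos)
        then show ?thesis using D(4)[of z] ZD z by (meson in_mono order_trans)
      qed
      show "barrier e p M (\<beta> * \<rho>) \<beta> z \<le> u z"
        if z: "z \<in> ?Z" and s: "e \<bullet> (z - p) = 4 * h" for z
      proof -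
        let ?t = "norm (perp e (z - p))"
        have b: "barrier e p M (\<beta> * \<rho>) \<beta> z = \<beta> * (T2 - ?t\<^sup>2)"
          unfolding bar s T2_def by (simp add: power2_eq_square)
        show ?thesis
        proof (cases "?t\<^sup>2 \<le> T2")
          case True
          have "(dist y z)\<^sup>2 \<le> (4 * h - (\<rho> + h))\<^sup>2 + T2" using dist_sq[of z] True s by simp
          also have "\<dots> = \<rho>\<^sup>2" unfolding T2_eq by (simp add: power2_eq_square algebra_simps)
          finally have "dist y z \<le> \<rho>" using \<rho> by (intro power2_le_imp_le[of "dist y z"]) auto
          then have "m \<le> u z" using low by simp
          moreover have "\<beta> * (T2 - ?t\<^sup>2) \<le> \<beta> * T2" using \<beta> by (intro mult_left_mono) auto
          moreover have "\<beta> * T2 = m" unfolding \<beta>_def using T2pos by simp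
          ultimately show ?thesis unfolding b by linarith
        next
          case False
          then have "\<beta> * (T2 - ?t\<^sup>2) \<le> 0" using \<beta> by (simp add: mult_nonneg_nonpos)
          then show ?thesis using D(4)[of z] ZD z b by (metis (no_types, lifting) in_mono order_trans)
        qed
      qed
    qed
    moreover have "p + (\<rho> + h - d) *\<^sub>R e = x"
    proof -
      have "p + (\<rho> + h - d) *\<^sub>R e = y - d *\<^sub>R e" unfolding p_def by (simp add: algebra_simps)
      then show ?thesis unfolding de by simp
    qed
    \<comment> \<open>The 12 comes from T2 \<le> 6\<rho>h and from the height of \<open>x\<close>
      being at least h/2.\<close>
    moreover have "m / 12 \<le> \<beta> * \<rho> * (\<rho> + h - d)"
    proof -
      have "T2 \<le> 6 * (\<rho> * h)" unfolding T2_eq using rh by simp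
      then have "m * T2 \<le> m * (6 * (\<rho> * h))" using m by (rule mult_left_mono)
      then have "m / 12 \<le> \<beta> * \<rho> * (h / 2)"
        unfolding \<beta>_def using T2pos by (simp add: field_simps)
      also have "\<dots> \<le> \<beta> * \<rho> * (\<rho> + h - d)"
        using d \<beta> \<rho> by (intro mult_left_mono) auto
      finally show ?thesis .
    qed
    ultimately show ?thesis by simp
  qed
qed

text \<open>Iterates \<open>ball_step\<close>. Capping the radius at \<open>R\<close> keeps the
  doubled ball inside \<open>D\<close> at every step.\<close>

lemma ball_growth:
  fixes y :: "real^'n"
  assumes \<rho>: "\<rho> > 0" "\<rho> \<le> R"
    and adm: "admissible D u" and sub: "cball y (2 * R) \<subseteq> D" and m: "m \<ge> 0"
    and low: "\<And>x. x \<in> cball y \<rho> \<Longrightarrow> m \<le> u x"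
  shows "\<forall>x\<in>cball y (min R (growth ^ k * \<rho>)). m / 12 ^ k \<le> u x"
proof (induction k)
  case 0
  then show ?case using low \<rho> by simp
next
  case (Suc k)
  let ?\<sigma> = "min R (growth ^ k * \<rho>)"
  have g: "growth ^ k > 0" using growth_gt_1 by simp
  have \<sigma>: "?\<sigma> > 0" using \<rho> g by simp
  have "cball y (2 * ?\<sigma>) \<subseteq> cball y (2 * R)" by (rule subset_cball) simp
  then have sub': "cball y (2 * ?\<sigma>) \<subseteq> D" using sub by simp
  have "min R (growth ^ Suc k * \<rho>) \<le> growth * ?\<sigma>"
  proof (cases "R \<le> growth ^ k * \<rho>")
    case True
    then have "growth * ?\<sigma> = growth * R" by simp
    moreover have "1 * R \<le> growth * R" using \<rho> growth_gt_1 by (intro mult_right_mono) auto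
    ultimately show ?thesis by linarith
  qed (simp add: mult.assoc)
  then have "cball y (min R (growth ^ Suc k * \<rho>)) \<subseteq> cball y (growth * ?\<sigma>)" by (rule subset_cball)
  moreover have "m / 12 ^ k / 12 \<le> u x" if "x \<in> cball y (growth * ?\<sigma>)" for x
  proof (rule ball_step[OF \<sigma> adm sub' _ _ that])
    show "m / 12 ^ k \<ge> 0" using m by simp
    show "m / 12 ^ k \<le> u z" if "z \<in> cball y ?\<sigma>" for z using Suc that by blast
  qed
  ultimately show ?case by (auto simp: mult.commute)
qed

section \<open>Uniform propagation along chains of balls\<close>

text \<open>The constant is chosen before \<open>D\<close>, \<open>u\<close> and \<open>m\<close>,
  so it depends on the three sets and the locale parameters alone. This gives the final constant its
  independence of \<Omega> and \<open>u\<close>.\<close>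

definition propagates :: "(real^'n) set \<Rightarrow> (real^'n) set \<Rightarrow> (real^'n) set \<Rightarrow> bool" where
  "propagates G A B \<longleftrightarrow> (\<exists>c>0. \<forall>D u m. admissible D u \<and> G \<subseteq> D \<and> 0 \<le> m \<and> (\<forall>x\<in>A. m \<le> u x)
     \<longrightarrow> (\<forall>x\<in>B. c * m \<le> u x))"

lemma propagates_trans:
  assumes "propagates G A B" "propagates G B C"
  shows "propagates G A C"
proof -
  obtain c where c: "c > 0" "\<And>D u m. \<lbrakk>admissible D u; G \<subseteq> D; 0 \<le> m; \<forall>x\<in>A. m \<le> u x\<rbrakk> \<Longrightarrow> \<forall>x\<in>B. c * m \<le> u x"
    using assms(1) unfolding propagates_def by meson
  obtain c' where c': "c' > 0" "\<And>D u m. \<lbrakk>admissible D u; G \<subseteq> D; 0 \<le> m; \<forall>x\<in>B. m \<le> u x\<rbrakk> \<Longrightarrow> \<forall>x\<in>C. c' * m \<le> u x"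
    using assms(2) unfolding propagates_def by meson
  show ?thesis unfolding propagates_def
  proof (intro exI[of _ "c' * c"] conjI allI impI)
    fix D u m assume h: "admissible D u \<and> G \<subseteq> D \<and> 0 \<le> m \<and> (\<forall>x\<in>A. m \<le> u x)"
    then have "\<forall>x\<in>B. c * m \<le> u x" using c(2) by blast
    then have "\<forall>x\<in>C. c' * (c * m) \<le> u x" using c'(2)[of D u "c * m"] h c(1) by simp
    then show "\<forall>x\<in>C. c' * c * m \<le> u x" by (simp add: mult.assoc)
  qed (use c c' in simp)
qed

lemma propagates_subset: "B \<subseteq> A \<Longrightarrow> propagates G A B"
  unfolding propagates_def by (intro exI[of _ 1]) auto

lemma propagates_mono: "\<lbrakk>propagates G A B; B' \<subseteq> B\<rbrakk> \<Longrightarrow> propagates G A B'"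
  using propagates_trans propagates_subset by blast

lemma propagates_Un:
  assumes "propagates G A B" "propagates G A C"
  shows "propagates G A (B \<union> C)"
proof -
  obtain c where c: "c > 0" "\<And>D u m. \<lbrakk>admissible D u; G \<subseteq> D; 0 \<le> m; \<forall>x\<in>A. m \<le> u x\<rbrakk> \<Longrightarrow> \<forall>x\<in>B. c * m \<le> u x"
    using assms(1) unfolding propagates_def by meson
  obtain c' where c': "c' > 0" "\<And>D u m. \<lbrakk>admissible D u; G \<subseteq> D; 0 \<le> m; \<forall>x\<in>A. m \<le> u x\<rbrakk> \<Longrightarrow> \<forall>x\<in>C. c' * m \<le> u x"
    using assms(2) unfolding propagates_def by meson
  show ?thesis unfolding propagates_def
  proof (intro exI[of _ "min c c'"] conjI allI impI ballI)
    fix D u m x assume h: "admissible D u \<and> G \<subseteq> D \<and> 0 \<le> m \<and> (\<forall>x\<in>A. m \<le> u x)" and x: "x \<in> B \<union> C"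
    have "min c c' * m \<le> c * m" "min c c' * m \<le> c' * m" using h by (auto intro!: mult_right_mono)
    then show "min c c' * m \<le> u x" using x c(2)[of D u m] c'(2)[of D u m] h by fastforce
  qed (use c c' in simp)
qed

text \<open>The number of growth steps needed is determined by R / \<rho> and \<open>growth\<close>,
  hence is the same for all supersolutions.\<close>

lemma propagates_ball:
  assumes \<rho>: "\<rho> > 0" and sub: "cball y (2 * R) \<subseteq> G"
  shows "propagates G (cball y \<rho>) (cball y R)"
proof (cases "\<rho> \<le> R")
  case True
  obtain k where "R / \<rho> < growth ^ k" using real_arch_pow[OF growth_gt_1] by blast
  then have k: "R \<le> growth ^ k * \<rho>" using \<rho> by (simp add: field_simps)
  show ?thesis unfolding propagates_def
  proof (intro exI[of _ "1 / 12 ^ k"] conjI allI impI)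
    fix D u m assume h: "admissible D u \<and> G \<subseteq> D \<and> 0 \<le> m \<and> (\<forall>x\<in>cball y \<rho>. m \<le> u x)"
    then have "\<forall>x\<in>cball y (min R (growth ^ k * \<rho>)). m / 12 ^ k \<le> u x"
      using sub by (intro ball_growth[OF \<rho> True]) blast+
    then show "\<forall>x\<in>cball y R. 1 / 12 ^ k * m \<le> u x" using k by (simp add: min_absorb1)
  qed simp
next
  case False
  then show ?thesis by (intro propagates_subset subset_cball) simp
qed

text \<open>Whether a bound reaches some ball about a point is a locally constant property, so
  connectedness carries it from \<open>a\<close> to \<open>b\<close>.\<close>

lemma propagates_point:
  assumes G: "open G" "connected G" and a: "a \<in> G" "s > 0" and b: "b \<in> G"
  shows "\<exists>r>0. propagates G (cball a s) (cball b r)"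
proof (rule connected_induction_simple[OF G(2) a(1) b])
  show "\<exists>r>0. propagates G (cball a s) (cball a r)" using a propagates_subset by blast
  fix z assume "z \<in> G"
  then obtain r where r: "r > 0" "ball z r \<subseteq> G" using G(1) open_contains_ball by blast
  \<comment> \<open>For \<open>x\<close> and \<open>y\<close> within R of \<open>z\<close>, the ball
    of radius 6R about \<open>x\<close> stays in the ball of radius 8R about \<open>z\<close>, and
    the ball of radius 3R about \<open>x\<close> contains the ball of radius R about
    \<open>y\<close>.\<close>
  define R where "R = r / 8"
  have R: "R > 0" "ball z (8 * R) \<subseteq> G" using r unfolding R_def by auto
  show "\<exists>T. openin (top_of_set G) T \<and> z \<in> T \<and>
      (\<forall>x\<in>T. \<forall>y\<in>T. (\<exists>r>0. propagates G (cball a s) (cball x r)) \<longrightarrow> (\<exists>r>0. propagates G (cball a s) (cball y r)))"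
  proof (intro exI[of _ "ball z R"] conjI ballI impI)
    have "ball z R \<subseteq> ball z (8 * R)" using R by (intro subset_ball) simp
    then show "openin (top_of_set G) (ball z R)" using R(2) by (intro open_subset) auto
    fix x y assume x: "x \<in> ball z R" and y: "y \<in> ball z R"
    assume "\<exists>r>0. propagates G (cball a s) (cball x r)"
    then obtain q where q: "q > 0" "propagates G (cball a s) (cball x q)" by blast
    have "cball x (2 * (3 * R)) \<subseteq> ball z (8 * R)"
      using x R by (auto simp: subset_iff) (smt (verit) dist_triangle)
    then have "propagates G (cball x q) (cball x (3 * R))"
      using q R by (intro propagates_ball) auto
    moreover have "cball y R \<subseteq> cball x (3 * R)"
      using x y R by (auto simp: subset_iff) (smt (verit) dist_triangle dist_commute)
    ultimately show "\<exists>r>0. propagates G (cball a s) (cball y r)"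
      using propagates_trans[OF q(2)] propagates_mono R(1) by blast
  qed (use R in auto)
qed

text \<open>Finitely many of the balls from \<open>propagates_point\<close> cover \<open>K\<close>;
  the least of their constants serves.\<close>

lemma propagates_compact:
  assumes G: "open G" "connected G" and a: "a \<in> G" "s > 0" and K: "compact K" "K \<subseteq> G"
  shows "propagates G (cball a s) K"
proof -
  have "\<forall>b\<in>K. \<exists>r>0. propagates G (cball a s) (cball b r)"
    using propagates_point[OF G a] K(2) by blast
  then obtain r where r: "\<And>b. b \<in> K \<Longrightarrow> r b > 0" "\<And>b. b \<in> K \<Longrightarrow> propagates G (cball a s) (cball b (r b))"
    by metis
  obtain F where F: "F \<subseteq> K" "finite F" "K \<subseteq> (\<Union>b\<in>F. ball b (r b))"
  proof (rule compactE_image[OF K(1), of K "\<lambda>b. ball b (r b)"])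
    show "K \<subseteq> (\<Union>b\<in>K. ball b (r b))" using r(1) by fastforce
  qed (auto)
  have "propagates G (cball a s) (\<Union>b\<in>F. cball b (r b))"
    using F(2,1)
  proof (induction rule: finite_induct)
    case empty
    then show ?case by (simp add: propagates_subset)
  next
    case (insert b F)
    then show ?case using propagates_Un[of G "cball a s"] r(2)[of b] by simp
  qed
  moreover have "K \<subseteq> (\<Union>b\<in>F. cball b (r b))" using F(3) ball_subset_cball by blast
  ultimately show ?thesis by (rule propagates_mono)
qed

section \<open>Iteration towards the boundary point\<close>

text \<open>This is \<open>cylinder_comparison\<close> along e_n with base point at distance
  \<open>s\<close> below \<open>x\<close>. The hypotheses range over all points with |z'| \<le> |x'|
  + T, a set containing the cylinder centred on the vertical line through \<open>x\<close>.\<close>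

lemma vertical_comparison:
  fixes u :: "real^'n \<Rightarrow> real"
  assumes adm: "admissible D u" and \<beta>: "\<beta> > 0" and T: "T \<ge> 0" and s: "0 \<le> s" "s \<le> h"
    and sub: "\<And>z. \<lbrakk>x $ N - s \<le> z $ N; z $ N \<le> x $ N - s + h; tangential_norm N z \<le> tangential_norm N x + T\<rbrakk> \<Longrightarrow> z \<in> D"
    and side: "\<And>z v. \<lbrakk>0 \<le> v; v \<le> h; z $ N = x $ N - s + v; tangential_norm N z \<le> tangential_norm N x + T\<rbrakk>
      \<Longrightarrow> k * v + \<beta> * (M * v\<^sup>2 - T\<^sup>2) \<le> u z"
    and top: "\<And>z. \<lbrakk>z $ N = x $ N - s + h; tangential_norm N z \<le> tangential_norm N x + T\<rbrakk>
      \<Longrightarrow> k * h + \<beta> * (M * h\<^sup>2) \<le> u z"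
  shows "k * s \<le> u x"
proof -
  let ?e = "axis N 1 :: real^'n"
  define p where "p = x - s *\<^sub>R ?e"
  have e: "norm ?e = 1" by simp
  have D: "open D" "bounded D" "pucci_supersolution lam Lam D u" "\<And>x. x \<in> D \<Longrightarrow> 0 \<le> u x"
    using adm unfolding admissible_def by blast+
  have pN: "p $ N = x $ N - s" unfolding p_def by (simp add: axis_def)
  have pT: "tangential_norm N p = tangential_norm N x"
    unfolding p_def norm_perp_axis[symmetric] perp_linear perp_self[OF e] by simp
  have tn: "tangential_norm N z \<le> tangential_norm N x + T" if "tangential_norm N (z - p) \<le> T" for z
    using tangential_norm_triangle[of N "z - p" p] pT that by simp
  let ?Z = "{z. 0 \<le> ?e \<bullet> (z - p) \<and> ?e \<bullet> (z - p) \<le> h \<and> norm (perp ?e (z - p)) \<le> T}"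
  have ZI: "0 \<le> z $ N - p $ N \<and> z $ N - p $ N \<le> h \<and> tangential_norm N z \<le> tangential_norm N x + T"
    if "z \<in> ?Z" for z
    using that tn[of z] unfolding inner_axis_1 norm_perp_axis by simp
  have ZD: "?Z \<subseteq> D"
  proof
    fix z assume "z \<in> ?Z"
    from ZI[OF this] show "z \<in> D" using pN by (intro sub) auto
  qed
  have "k * s \<le> u (p + s *\<^sub>R ?e)"
  proof (rule cylinder_comparison[OF D(3,1,2) e \<beta> ZD T _ _ _ s])
    show "0 \<le> u z" if "z \<in> ?Z" for z using D(4) that ZD by blast
    show "barrier ?e p M k \<beta> z \<le> u z" if z: "z \<in> ?Z" and t: "norm (perp ?e (z - p)) = T" for z
    proof -
      have "k * (z $ N - p $ N) + \<beta> * (M * (z $ N - p $ N)\<^sup>2 - T\<^sup>2) \<le> u z"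
        using ZI[OF z] pN by (intro side) auto
      then show ?thesis unfolding barrier_def t inner_axis_1 by simp
    qed
    show "barrier ?e p M k \<beta> z \<le> u z" if z: "z \<in> ?Z" and v: "?e \<bullet> (z - p) = h" for z
    proof -
      have "k * h + \<beta> * (M * h\<^sup>2) \<le> u z"
        using ZI[OF z] pN v unfolding inner_axis_1 by (intro top) auto
      moreover have "\<beta> * (M * h\<^sup>2 - (norm (perp ?e (z - p)))\<^sup>2) \<le> \<beta> * (M * h\<^sup>2)"
        using \<beta> by (intro mult_left_mono) auto
      ultimately show ?thesis unfolding barrier_def v by linarith
    qed
  qed
  then show ?thesis unfolding p_def by simp
qed

text \<open>Turns a constant bound away from the flat piece into a linear one down to it: below the
  piece nonnegativity suffices, above height \<open>h\<close> the constant bound does, and a barrier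
  covers the layer between.\<close>

lemma flat_start:
  fixes x :: "real^'n"
  assumes adm: "admissible D u" and R: "R > 0" and g: "0 < g" "g \<le> 1/2" and b: "b > 0"
    and cyl: "\<And>z. \<lbrakk>g * R \<le> z $ N; z $ N \<le> R; tangential_norm N z \<le> R\<rbrakk> \<Longrightarrow> z \<in> D"
    and low: "\<And>z. \<lbrakk>R / (4 * (M + 1)) \<le> z $ N; z $ N \<le> R; tangential_norm N z \<le> R\<rbrakk> \<Longrightarrow> b \<le> u z"
    and x: "x \<in> D" "x $ N \<le> R / 2" "tangential_norm N x \<le> R / 2"
  shows "b / R * (x $ N - g * R) \<le> u x"
proof -
  define h where "h = R / (4 * (M + 1))"
  have M0: "M > 0" by (rule M_pos)
  have h0: "h > 0" unfolding h_def using R M0 by simp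
  have hM: "4 * (M + 1) * h = R" unfolding h_def using M0 by simp
  have Mh: "0 < M * h" using M0 h0 by simp
  have h4: "4 * h \<le> R" using hM Mh by (simp add: distrib_left distrib_right)
  consider "x $ N \<le> g * R" | "x $ N \<ge> h" | "x $ N > g * R" "x $ N < h" by linarith
  then show ?thesis
  proof cases
    case 1
    then have "b / R * (x $ N - g * R) \<le> 0" using b R by (intro mult_nonneg_nonpos) auto
    moreover have "0 \<le> u x" using adm x(1) unfolding admissible_def by blast
    ultimately show ?thesis by linarith
  next
    case 2
    have "0 < g * R" using g R by simp
    then have "b / R * (x $ N - g * R) \<le> b / R * R" using b R x(2) by (intro mult_left_mono) auto
    also have "\<dots> = b" using R by simp
    also have "\<dots> \<le> u x" using 2 x R by (intro low[folded h_def]) auto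
    finally show ?thesis .
  next
    case 3
    define s where "s = x $ N - g * R"
    have xs: "x $ N - s = g * R" unfolding s_def by simp
    have gR: "0 < g * R" "g * R \<le> R / 2" using g R mult_right_mono[OF g(2), of R] by auto
    have s: "0 \<le> s" "s \<le> h" using 3 gR unfolding s_def by auto
    \<comment> \<open>Chosen so that the lateral radius R/2 gives \<beta>(R/2)^2 = b.\<close>
    define \<beta> where "\<beta> = 4 * b / R\<^sup>2"
    have \<beta>: "\<beta> > 0" unfolding \<beta>_def using b R by simp
    have \<beta>R: "\<beta> * (R / 2)\<^sup>2 = b" unfolding \<beta>_def using R by (simp add: power_divide)
    \<comment> \<open>One estimate serves both faces: the barrier is at most 0 on the side and at
      most \<open>b\<close> on the top. The height h = R / (4(M+1)) makes R(M+1)h equal to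
      (R/2)^2.\<close>
    have q: "R * v + M * v\<^sup>2 \<le> (R / 2)\<^sup>2" if v: "0 \<le> v" "v \<le> h" for v
    proof -
      have "M * v\<^sup>2 \<le> M * (v * R)"
        unfolding power2_eq_square using v h4 M0 h0 by (intro mult_left_mono) auto
      then have "R * v + M * v\<^sup>2 \<le> R * ((M + 1) * v)" by (simp add: algebra_simps)
      also have "\<dots> \<le> R * ((M + 1) * h)" using v R M0 by (intro mult_left_mono) auto
      also have "(M + 1) * h = R / 4" using hM by (simp add: distrib_right)
      also have "R * (R / 4) = (R / 2)\<^sup>2" by (simp add: power2_eq_square)
      finally show ?thesis .
    qed
    have "\<beta> * R * s \<le> u x"
    proof (rule vertical_comparison[OF adm \<beta> _ s, where T = "R / 2" and N = N])
      show "z \<in> D" if "x $ N - s \<le> z $ N" "z $ N \<le> x $ N - s + h" "tangential_norm N z \<le> tangential_norm N x + R / 2" for z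
        using that x(3) gR h4 R unfolding xs by (intro cyl) linarith+
      show "\<beta> * R * v + \<beta> * (M * v\<^sup>2 - (R / 2)\<^sup>2) \<le> u z"
        if "0 \<le> v" "v \<le> h" "z $ N = x $ N - s + v" "tangential_norm N z \<le> tangential_norm N x + R / 2" for v z
      proof -
        have "\<beta> * (R * v + M * v\<^sup>2 - (R / 2)\<^sup>2) \<le> 0"
          using \<beta> q[OF that(1,2)] by (intro mult_nonneg_nonpos) auto
        moreover have "z \<in> D" using that x(3) gR h4 R unfolding xs by (intro cyl) linarith+
        then have "0 \<le> u z" using adm unfolding admissible_def by blast
        ultimately show ?thesis by (simp add: algebra_simps)
      qed
      show "\<beta> * R * h + \<beta> * (M * h\<^sup>2) \<le> u z"
        if "z $ N = x $ N - s + h" "tangential_norm N z \<le> tangential_norm N x + R / 2" for z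
      proof -
        have "\<beta> * (R * h + M * h\<^sup>2) \<le> \<beta> * (R / 2)\<^sup>2"
          using \<beta> q[of h] h0 by (intro mult_left_mono) auto
        also have "\<dots> = b" by (rule \<beta>R)
        also have "b \<le> u z" using that x(3) gR h4 R unfolding xs by (intro low[folded h_def]) linarith+
        finally show ?thesis by (simp only: distrib_left mult.assoc)
      qed
    qed (use R in simp)
    moreover have "b / R \<le> \<beta> * R" unfolding \<beta>_def using b R by (simp add: power2_eq_square divide_right_mono)
    then have "b / R * s \<le> \<beta> * R * s" using s by (intro mult_right_mono) auto
    ultimately show ?thesis unfolding s_def by linarith
  qed
qed

text \<open>The old bound with error \<eta>r serves as boundary data on a cylinder standing on the
  new flat piece. The quadratic term of the barrier absorbs the error, at the price of the slope
  factor 1 - 4(M+1)\<eta>.\<close>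

lemma flat_step:
  fixes x :: "real^'n"
  assumes adm: "admissible D u" and r: "r > 0" and g: "0 < g" "g \<le> 1/2"
    and \<eta>: "\<eta> > 0" "4 * (M + 1) * \<eta> \<le> 1" and a: "a > 0"
    and cyl: "\<And>z. \<lbrakk>g * r \<le> z $ N; z $ N \<le> r; tangential_norm N z \<le> r\<rbrakk> \<Longrightarrow> z \<in> D"
    and low: "\<And>z. \<lbrakk>z \<in> D; z $ N \<le> r; tangential_norm N z \<le> r\<rbrakk> \<Longrightarrow> a * (z $ N - \<eta> * r) \<le> u z"
    and x: "x \<in> D" "x $ N \<le> r / 2" "tangential_norm N x \<le> r / 2"
  shows "a * (1 - 4 * (M + 1) * \<eta>) * (x $ N - g * r) \<le> u x"
proof (cases "x $ N \<le> g * r")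
  case True
  then have "a * (1 - 4 * (M + 1) * \<eta>) * (x $ N - g * r) \<le> 0" using a \<eta> by (intro mult_nonneg_nonpos mult_nonneg_nonneg) auto
  moreover have "0 \<le> u x" using adm x(1) unfolding admissible_def by blast
  ultimately show ?thesis by linarith
next
  case False
  have M0: "M > 0" by (rule M_pos)
  define s where "s = x $ N - g * r"
  have xs: "x $ N - s = g * r" unfolding s_def by simp
  have gr: "0 < g * r" "g * r \<le> r / 2" using g r mult_right_mono[OF g(2), of r] by auto
  have s: "0 \<le> s" "s \<le> r / 2" using False x gr unfolding s_def by auto
  define k where "k = a * (1 - 4 * (M + 1) * \<eta>)"
  \<comment> \<open>With lateral radius r/2 the negative term \<beta>(r/2)^2 is exactly a\<eta>r,
    the error in the known bound.\<close>
  define \<beta> where "\<beta> = 4 * a * \<eta> / r"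
  have \<beta>: "\<beta> > 0" unfolding \<beta>_def using a \<eta> r by simp
  have a\<eta>: "a * \<eta> > 0" using a \<eta> by simp
  have low': "a * (v - \<eta> * r) \<le> u z"
    if "0 \<le> v" "v \<le> r / 2" "z $ N = x $ N - s + v" "tangential_norm N z \<le> tangential_norm N x + r / 2" for v z
  proof -
    have zr: "g * r \<le> z $ N" "z $ N \<le> r" "tangential_norm N z \<le> r"
      using that x(3) gr unfolding xs by linarith+
    have "a * (v - \<eta> * r) \<le> a * (z $ N - \<eta> * r)"
      using a that(3) gr unfolding xs by (intro mult_left_mono) auto
    also have "\<dots> \<le> u z" by (rule low[OF cyl[OF zr] zr(2,3)])
    finally show ?thesis .
  qed
  have "k * s \<le> u x"
  proof (rule vertical_comparison[OF adm \<beta> _ s, where T = "r / 2" and N = N])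
    show "z \<in> D" if "x $ N - s \<le> z $ N" "z $ N \<le> x $ N - s + r / 2" "tangential_norm N z \<le> tangential_norm N x + r / 2" for z
      using that x(3) gr unfolding xs by (intro cyl) linarith+
    show "k * v + \<beta> * (M * v\<^sup>2 - (r / 2)\<^sup>2) \<le> u z"
      if v: "0 \<le> v" "v \<le> r / 2" "z $ N = x $ N - s + v" "tangential_norm N z \<le> tangential_norm N x + r / 2" for v z
    proof -
      have "v * v \<le> v * (r / 2)" using v by (intro mult_left_mono) auto
      then have "v\<^sup>2 / r \<le> v / 2" using r by (simp add: power2_eq_square field_simps)
      then have "M * (v\<^sup>2 / r) \<le> M * (v / 2)" using M0 by (intro mult_left_mono) auto
      moreover have "M * (v / 2) \<le> (M + 1) * v"
      proof -
        have "0 \<le> M * v" using v(1) M0 by simp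
        then have "M * v / 2 \<le> M * v + v" using v(1) by linarith
        then show ?thesis by (simp only: distrib_right mult_1_left times_divide_eq_right)
      qed
      \<comment> \<open>The convex term costs at most the slope that was given up in
        \<open>k\<close>.\<close>
      ultimately have "M * (v\<^sup>2 / r) \<le> (M + 1) * v" by linarith
      then have "4 * (a * \<eta>) * (M * (v\<^sup>2 / r)) \<le> 4 * (a * \<eta>) * ((M + 1) * v)" using a\<eta> by (intro mult_left_mono) auto
      moreover have "k * v + \<beta> * (M * v\<^sup>2 - (r / 2)\<^sup>2)
         = a * (v - \<eta> * r) + 4 * (a * \<eta>) * (M * (v\<^sup>2 / r)) - 4 * (a * \<eta>) * ((M + 1) * v)"
        unfolding k_def \<beta>_def using r by (simp add: field_simps power2_eq_square)
      ultimately show ?thesis using low'[OF v] by linarith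
    qed
    show "k * (r / 2) + \<beta> * (M * (r / 2)\<^sup>2) \<le> u z"
      if "z $ N = x $ N - s + r / 2" "tangential_norm N z \<le> tangential_norm N x + r / 2" for z
    proof -
      have "k * (r / 2) + \<beta> * (M * (r / 2)\<^sup>2) = a * (r / 2 - \<eta> * r) - a * \<eta> * r * (M + 1)"
        unfolding k_def \<beta>_def using r by (simp add: field_simps power2_eq_square)
      also have "\<dots> \<le> a * (r / 2 - \<eta> * r)" using a\<eta> r M0 by simp
      also have "\<dots> \<le> u z" using that r by (intro low') auto
      finally show ?thesis .
    qed
  qed (use r in simp)
  then show ?thesis unfolding k_def s_def .
qed

text \<open>Each halving of the scale multiplies the slope by 1 - 8(M+1) g k. The product of these
  factors is bounded below by 1 minus the sum, so the slope never falls below half of b/R.\<close>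

lemma flat_iterate:
  fixes x :: "real^'n"
  assumes adm: "admissible D u" and R: "R > 0" and b: "b > 0"
    and g: "\<And>k. 0 < g k" "\<And>k. g k \<le> 1/2"
    and sum: "\<And>k. 8 * (M + 1) * (\<Sum>i<k. g i) \<le> 1/2"
    and cyl: "\<And>k z. \<lbrakk>g k * (R / 2 ^ k) \<le> z $ N; z $ N \<le> R / 2 ^ k; tangential_norm N z \<le> R / 2 ^ k\<rbrakk> \<Longrightarrow> z \<in> D"
    and low: "\<And>z. \<lbrakk>R / (4 * (M + 1)) \<le> z $ N; z $ N \<le> R; tangential_norm N z \<le> R\<rbrakk> \<Longrightarrow> b \<le> u z"
    and x: "x \<in> D" "x $ N \<le> R / 2 ^ Suc k" "tangential_norm N x \<le> R / 2 ^ Suc k"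
  shows "b / R * (1 - 8 * (M + 1) * (\<Sum>i<k. g i)) * (x $ N - g k * (R / 2 ^ k)) \<le> u x"
  using x
proof (induction k arbitrary: x)
  case 0
  have "b / R * (x $ N - g 0 * R) \<le> u x"
    using 0 cyl[of 0] by (intro flat_start[OF adm R g b _ low]) auto
  then show ?case by simp
next
  case (Suc k)
  have M0: "M > 0" by (rule M_pos)
  let ?r = "R / 2 ^ Suc k" and ?S = "8 * (M + 1) * (\<Sum>i<k. g i)" and ?q = "8 * (M + 1) * g k"
  have Sq: "8 * (M + 1) * (\<Sum>i<Suc k. g i) = ?S + ?q" by (simp add: distrib_left)
  have S0: "0 \<le> ?S" using g(1) M0 by (intro mult_nonneg_nonneg sum_nonneg) (auto intro: less_imp_le)
  have q0: "0 \<le> ?q" using g(1)[of k] M0 by simp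
  have Sq_le: "?S + ?q \<le> 1/2" using sum[of "Suc k"] unfolding Sq .
  have r: "?r > 0" using R by simp
  have bR: "b / R > 0" using b R by simp
  \<comment> \<open>The error g k R/2^k of scale \<open>k\<close> is 2 g k times the next radius,
    whence \<eta> = 2 g k.\<close>
  have step: "b / R * (1 - ?S) * (1 - 4 * (M + 1) * (2 * g k)) * (x $ N - g (Suc k) * ?r) \<le> u x"
  proof (rule flat_step[OF adm r g(1,2)])
    show "0 < 2 * g k" using g(1)[of k] by simp
    have "4 * (M + 1) * (2 * g k) = ?q" by (simp add: algebra_simps)
    then show "4 * (M + 1) * (2 * g k) \<le> 1" using Sq_le S0 by linarith
    show "0 < b / R * (1 - ?S)" using bR Sq_le q0 by (intro mult_pos_pos) auto
    show "z \<in> D" if "g (Suc k) * ?r \<le> z $ N" "z $ N \<le> ?r" "tangential_norm N z \<le> ?r" for z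
      using that by (rule cyl)
    show "b / R * (1 - ?S) * (z $ N - 2 * g k * ?r) \<le> u z"
      if "z \<in> D" "z $ N \<le> ?r" "tangential_norm N z \<le> ?r" for z
      using Suc.IH[OF that] by simp
    show "x \<in> D" "x $ N \<le> ?r / 2" "tangential_norm N x \<le> ?r / 2"
      using Suc.prems by simp_all
  qed
  show ?case
  proof (cases "x $ N \<le> g (Suc k) * ?r")
    case True
    have "b / R * (1 - (?S + ?q)) * (x $ N - g (Suc k) * ?r) \<le> 0"
      using bR Sq_le True by (intro mult_nonneg_nonpos mult_nonneg_nonneg) auto
    moreover have "0 \<le> u x" using adm Suc.prems(1) unfolding admissible_def by blast
    ultimately show ?thesis unfolding Sq by linarith
  next
    case False
    have "1 - (?S + ?q) \<le> (1 - ?S) * (1 - ?q)"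
      using mult_nonneg_nonneg[OF S0 q0] by (simp only: left_diff_distrib right_diff_distrib mult_1_left mult_1_right)
    then have "b / R * (1 - (?S + ?q)) * (x $ N - g (Suc k) * ?r)
        \<le> b / R * ((1 - ?S) * (1 - ?q)) * (x $ N - g (Suc k) * ?r)"
      using bR False by (intro mult_right_mono mult_left_mono) auto
    also have "\<dots> = b / R * (1 - ?S) * (1 - 4 * (M + 1) * (2 * g k)) * (x $ N - g (Suc k) * ?r)"
      by (simp only: mult.assoc) simp
    also note step
    finally show ?thesis unfolding Sq .
  qed
qed

end

section \<open>Dyadic form of the Dini condition and geometry of the region at the boundary
  point\<close>

text \<open>On the dyadic interval (a/2, a] monotonicity gives \<omega>(r)/r \<ge> \<omega>(a/2)/a,
  so the integral there is at least \<omega>(a/2)/2. The intervals are disjoint, hence the Dini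
  integral bounds the partial sums.\<close>

lemma dini_summable:
  assumes "dini_function \<omega>"
  shows "summable (\<lambda>k. \<omega> (1 / 2 ^ k))"
proof -
  from assms obtain r0 where mono: "mono_on {0..} \<omega>" and nn: "\<And>r. 0 \<le> r \<Longrightarrow> 0 \<le> \<omega> r"
    and r0: "r0 > 0" and int: "set_integrable lborel {0<..<r0} (\<lambda>r. \<omega> r / r)"
    unfolding dini_function_def by blast
  obtain K where K: "(1/2::real) ^ K < r0" using real_arch_pow_inv[OF r0, of "1/2"] by auto
  define a where "a k = (1/2::real) ^ (K + k)" for k
  have apos: "a k > 0" and aS: "a k = 2 * a (Suc k)" for k unfolding a_def by simp_all
  have ar0: "a k < r0" for k
  proof -
    have "a k \<le> (1/2) ^ K" unfolding a_def by (rule power_decreasing) auto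
    then show ?thesis using K by simp
  qed
  let ?f = "\<lambda>r. \<omega> r / r"
  have sub: "set_integrable lborel A ?f" if "A \<subseteq> {0<..<r0}" "A \<in> sets borel" for A
    using set_integrable_subset[OF int _ that(1)] that(2) by simp
  have piece: "\<omega> (a (Suc k)) / 2 \<le> (LINT r:{a (Suc k)<..a k}|lborel. ?f r)" for k
  proof -
    have "(LINT r:{a (Suc k)<..a k}|lborel. \<omega> (a (Suc k)) / a k) \<le> (LINT r:{a (Suc k)<..a k}|lborel. ?f r)"
    proof (rule set_integral_mono)
      show "set_integrable lborel {a (Suc k)<..a k} (\<lambda>r. \<omega> (a (Suc k)) / a k)"
        unfolding set_integrable_def by (simp add: aS[of k] apos less_imp_le)
      show "set_integrable lborel {a (Suc k)<..a k} ?f"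
        by (rule sub) (use apos[of "Suc k"] ar0[of k] in auto)
      show "\<omega> (a (Suc k)) / a k \<le> \<omega> r / r" if "r \<in> {a (Suc k)<..a k}" for r
      proof -
        have r: "0 < r" "r \<le> a k" "a (Suc k) \<le> r" using that apos[of "Suc k"] by auto
        have "\<omega> (a (Suc k)) \<le> \<omega> r"
          using mono_onD[OF mono, of "a (Suc k)" r] r apos[of "Suc k"] by simp
        then show ?thesis using r nn[of r] by (intro frac_le) auto
      qed
    qed
    also have "(LINT r:{a (Suc k)<..a k}|lborel. \<omega> (a (Suc k)) / a k) = \<omega> (a (Suc k)) / 2"
      unfolding set_lebesgue_integral_def using apos[of "Suc k"] by (simp add: aS[of k])
    finally show ?thesis .
  qed
  have "(\<Sum>k<n. \<omega> (a (Suc k)) / 2) \<le> (LINT r:{a n<..<r0}|lborel. ?f r)" for n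
  proof (induction n)
    case 0
    have "0 \<le> (LINT r:{a 0<..<r0}|lborel. ?f r)"
      unfolding set_lebesgue_integral_def
      using apos[of 0] by (intro integral_nonneg_AE AE_I2) (auto simp: indicator_def intro!: divide_nonneg_nonneg nn)
    then show ?case by simp
  next
    case (Suc n)
    have eq: "{a (Suc n)<..<r0} = {a (Suc n)<..a n} \<union> {a n<..<r0}"
      using aS[of n] apos[of "Suc n"] ar0[of n] by auto
    have "(LINT r:{a (Suc n)<..<r0}|lborel. ?f r)
        = (LINT r:{a (Suc n)<..a n}|lborel. ?f r) + (LINT r:{a n<..<r0}|lborel. ?f r)"
      unfolding eq
    proof (rule set_integral_Un)
      show "set_integrable lborel {a (Suc n)<..a n} ?f"
        by (rule sub) (use apos[of "Suc n"] ar0[of n] in auto)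
      show "set_integrable lborel {a n<..<r0} ?f"
        by (rule sub) (use apos[of n] in auto)
    qed auto
    then show ?case using Suc piece[of n] by simp
  qed
  moreover have "(LINT r:{a n<..<r0}|lborel. ?f r) \<le> (LINT r:{0<..<r0}|lborel. ?f r)" for n
    unfolding set_lebesgue_integral_def
  proof (rule integral_mono)
    show "integrable lborel (\<lambda>r. indicator {0<..<r0} r *\<^sub>R ?f r)"
      using int unfolding set_integrable_def .
    have "set_integrable lborel {a n<..<r0} ?f" by (rule sub) (use apos[of n] in auto)
    then show "integrable lborel (\<lambda>r. indicator {a n<..<r0} r *\<^sub>R ?f r)"
      unfolding set_integrable_def .
    show "indicator {a n<..<r0} r *\<^sub>R ?f r \<le> indicator {0<..<r0} r *\<^sub>R ?f r" for r
      using nn[of r] apos[of n] by (auto simp: indicator_def)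
  qed
  ultimately have bd: "(\<Sum>k<n. \<omega> (a (Suc k)) / 2) \<le> (LINT r:{0<..<r0}|lborel. ?f r)" for n
    using order_trans by blast
  have "summable (\<lambda>k. \<omega> (a (Suc k)) / 2)"
    by (rule summableI_nonneg_bounded[OF _ bd]) (use nn apos less_imp_le in auto)
  then have "summable (\<lambda>k. \<omega> (a (Suc k)))" by simp
  \<comment> \<open>The intervals start below \<open>r0\<close>, so this is a tail of the series;
    finitely many initial terms are then restored.\<close>
  then have "summable (\<lambda>k. \<omega> (1 / 2 ^ (k + Suc K)))"
    by (simp add: a_def power_one_over add.commute)
  then show ?thesis by (rule summable_iff_shift[THEN iffD1])
qed

lemma norm_le_tangential: "norm x \<le> tangential_norm N x + \<bar>x $ N\<bar>"
proof -
  have "x = perp (axis N 1) x + (x $ N) *\<^sub>R axis N 1"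
    unfolding perp_def inner_axis_1 by simp
  then have "norm x \<le> norm (perp (axis N 1) x) + norm ((x $ N) *\<^sub>R axis N (1::real))"
    by (metis norm_triangle_ineq)
  then show ?thesis by (simp add: norm_perp_axis)
qed

text \<open>Convexity follows from the triangle inequality and homogeneity of the tangential norm;
  it supplies the connectedness of the propagation region.\<close>

lemma tangential_cone:
  fixes N :: "'n::finite"
  assumes "c \<ge> 0"
  shows "convex {x. c * tangential_norm N x < x $ N}" "open {x. c * tangential_norm N x < x $ N}"
proof -
  show "open {x. c * tangential_norm N x < x $ N}"
    unfolding norm_perp_axis[symmetric] perp_def by (intro open_Collect_less continuous_intros)
  show "convex {x. c * tangential_norm N x < x $ N}"
  proof (rule convexI, unfold mem_Collect_eq)
    fix x y :: "real^'n" and v w :: real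
    assume x: "c * tangential_norm N x < x $ N" and y: "c * tangential_norm N y < y $ N"
      and vw: "0 \<le> v" "0 \<le> w" "v + w = 1"
    have "c * tangential_norm N (v *\<^sub>R x + w *\<^sub>R y) \<le> c * (v * tangential_norm N x + w * tangential_norm N y)"
      using tangential_norm_triangle[of N "v *\<^sub>R x" "w *\<^sub>R y"] vw assms
      by (intro mult_left_mono) (simp_all add: tangential_norm_scaleR)
    also have "\<dots> = v * (c * tangential_norm N x) + w * (c * tangential_norm N y)"
      by (simp add: algebra_simps)
    also have "\<dots> < v * x $ N + w * y $ N"
    \<comment> \<open>Strictness has to come from a point of positive weight.\<close>
    proof (cases "v = 0")
      case True
      then show ?thesis using y vw by simp
    next
      case False
      then have "v * (c * tangential_norm N x) < v * x $ N" using x vw by simp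
      moreover have "w * (c * tangential_norm N y) \<le> w * y $ N" using y vw by (intro mult_left_mono) auto
      ultimately show ?thesis by linarith
    qed
    finally show "c * tangential_norm N (v *\<^sub>R x + w *\<^sub>R y) < (v *\<^sub>R x + w *\<^sub>R y) $ N" by simp
  qed
qed

lemma ex_dyadic_scale:
  fixes t :: real
  assumes "0 < t" "t \<le> 1"
  shows "\<exists>k. 1 / 2 ^ Suc k < t \<and> t \<le> 1 / 2 ^ k"
proof -
  have "\<exists>n. (1/2) ^ n < t" using real_arch_pow_inv[OF assms(1), of "1/2"] by simp
  then have ex: "\<exists>n. 1 / 2 ^ n < t" by (simp add: power_one_over)
  define n where "n = (LEAST n. 1 / 2 ^ n < t)"
  have n: "1 / 2 ^ n < t" unfolding n_def using ex by (rule LeastI_ex)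
  then have "n \<noteq> 0" using assms(2) by (intro notI) simp
  then obtain k where k: "n = Suc k" using not0_implies_Suc by blast
  have "\<not> 1 / 2 ^ k < t" using not_less_Least[of k "\<lambda>n. 1 / 2 ^ n < t"] k unfolding n_def by simp
  then show ?thesis using n k by (intro exI[of _ k]) auto
qed

text \<open>A connected region guaranteed by \<omega> alone. The cone of slope 1/4 contains e_n/2,
  and near the origin, where \<omega> is at most \<open>c\<close>, the cone of slope
  \<open>c\<close> is allowed as well.\<close>

lemma hopf_region:
  fixes N :: "'n::finite"
  defines "t \<equiv> tangential_norm N"
  assumes \<omega>: "dini_function \<omega>" "\<omega> 1 < 1/4" and R: "R > 0" "4 * R \<le> 1" and c: "c > 0" "\<omega> (4 * R) \<le> c"
  defines "G \<equiv> (ball 0 1 \<inter> {x. 1/4 * t x < x $ N}) \<union> (ball 0 (4 * R) \<inter> {x. c * t x < x $ N})"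
  shows "open G" "connected G" "G \<subseteq> ball 0 1 \<inter> {x. t x * \<omega> (t x) < x $ N}"
proof -
  have mono: "\<omega> x \<le> \<omega> y" if "0 \<le> x" "x \<le> y" for x y
    using \<omega>(1) that unfolding dini_function_def mono_on_def by auto
  show "open G" unfolding G_def t_def
    by (intro open_Un open_Int open_ball tangential_cone(2)) (use c in simp_all)
  \<comment> \<open>Both convex pieces contain this point, so their union is connected.\<close>
  have "R *\<^sub>R axis N 1 \<in> (ball 0 1 \<inter> {x. 1/4 * t x < x $ N}) \<inter> (ball 0 (4 * R) \<inter> {x. c * t x < x $ N})"
    using R unfolding t_def by (simp add: norm_perp_axis[symmetric] perp_linear perp_self)
  then have ne: "(ball 0 1 \<inter> {x. 1/4 * t x < x $ N}) \<inter> (ball 0 (4 * R) \<inter> {x. c * t x < x $ N}) \<noteq> {}"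
    by blast
  show "connected G" unfolding G_def
    by (rule connected_Un[OF _ _ ne]; intro convex_connected convex_Int convex_ball)
      (use c in \<open>auto simp only: t_def intro!: tangential_cone(1)\<close>)
  show "G \<subseteq> ball 0 1 \<inter> {x. t x * \<omega> (t x) < x $ N}"
  proof
    fix x assume x: "x \<in> G"
    have t0: "0 \<le> t x" "t x \<le> norm x" unfolding t_def by (simp_all add: tangential_norm_nonneg tangential_norm_le)
    from x consider "norm x < 1" "1/4 * t x < x $ N" | "norm x < 4 * R" "c * t x < x $ N"
      unfolding G_def by auto
    then show "x \<in> ball 0 1 \<inter> {x. t x * \<omega> (t x) < x $ N}"
    proof cases
      case 1
      have "\<omega> (t x) \<le> 1/4" using mono[of "t x" 1] t0 1 \<omega>(2) by linarith
      then have "t x * \<omega> (t x) \<le> t x * (1/4)" using t0(1) by (rule mult_left_mono)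
      then show ?thesis using 1 by simp
    next
      case 2
      have "\<omega> (t x) \<le> c" using mono[of "t x" "4 * R"] t0 2 c(2) by linarith
      then have "t x * \<omega> (t x) \<le> t x * c" using t0(1) by (rule mult_left_mono)
      then show ?thesis using 2 R by (simp add: mult.commute)
    qed
  qed
qed

section \<open>Linear growth along rays from the boundary point\<close>

theorem theorem1p17:
  fixes N :: "'n::finite" and lam Lam :: real and \<omega> :: "real \<Rightarrow> real"
  assumes "0 < lam" and "lam \<le> Lam"
    and "dini_function \<omega>" and "\<omega> 1 < 1/4"
  shows "\<exists>c>0. \<forall>l::real^'n. norm l = 1 \<and> l $ N > 0 \<longrightarrow>
    (\<exists>\<delta>>0. \<forall>(\<Omega> :: (real^'n) set) (u :: real^'n \<Rightarrow> real).
      open \<Omega> \<and> connected \<Omega> \<and> interior_C1_Dini N 1 \<omega> \<Omega> \<and>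
      pucci_supersolution lam Lam (\<Omega> \<inter> ball 0 1) u \<and>
      u 0 = 0 \<and> (\<forall>x\<in>\<Omega> \<inter> ball 0 1. 0 \<le> u x) \<longrightarrow>
      (\<forall>r. 0 < r \<and> r < \<delta> \<longrightarrow>
        u (r *\<^sub>R l) \<ge> c * l $ N * (INF x\<in>ball ((1/2) *\<^sub>R axis N 1) (1/8). u x) * r))"
proof -
  define M where "M = real CARD('n) * Lam / lam + 1"
  interpret pucci_bounds lam Lam M "TYPE('n)"
    by unfold_locales (use assms(1,2) in \<open>auto simp: M_def field_simps\<close>)
  have M0: "M > 0" by (rule M_pos)
  let ?t = "tangential_norm N :: real^'n \<Rightarrow> real"
  have \<omega>0: "0 \<le> \<omega> r" if "0 \<le> r" for r
    using assms(3) that unfolding dini_function_def by blast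
  have \<omega>_mono: "\<omega> x \<le> \<omega> y" if "0 \<le> x" "x \<le> y" for x y
    using assms(3) that unfolding dini_function_def mono_on_def by auto
  \<comment> \<open>The added 2^-k makes \<open>f\<close> positive and strictly larger than \<omega>
    at dyadic radii while keeping the series summable.\<close>
  define f where "f k = \<omega> (1 / 2 ^ k) + 1 / 2 ^ k" for k :: nat
  have f_pos: "0 < f k" and f_gt: "\<omega> (1 / 2 ^ k) < f k" for k
    unfolding f_def using \<omega>0[of "1 / 2 ^ k"] by (auto intro: add_nonneg_pos)
  have "summable (\<lambda>k. (1/2::real) ^ k)" by (rule summable_geometric) simp
  then have f_sum: "summable f"
    unfolding f_def using dini_summable[OF assms(3)] by (intro summable_add) (simp_all add: power_one_over)
  \<comment> \<open>A tail below 1 / (16(M+1)) makes the total slope loss 8(M+1) \<Sum> g at most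
    1/2.\<close>
  have "1 / (16 * (M + 1)) > 0" using M0 by simp
  then obtain K where K: "\<And>n. K \<le> n \<Longrightarrow> norm (\<Sum>i. f (i + n)) < 1 / (16 * (M + 1))"
    using suminf_exist_split[OF _ f_sum] by blast
  have tail: "(\<Sum>i<k. f (i + n)) \<le> 1 / (16 * (M + 1))" if "K \<le> n" for n k
  proof -
    have "(\<Sum>i<k. f (i + n)) \<le> (\<Sum>i. f (i + n))"
      using f_sum f_pos by (intro sum_le_suminf summable_ignore_initial_segment) (auto intro: less_imp_le)
    then show ?thesis using K[OF that] by simp
  qed
  have f_le: "f n \<le> 1 / (16 * (M + 1))" if "K \<le> n" for n
    using tail[OF that, of 1] by simp
  \<comment> \<open>The shift by 2 gives 4R = 2^-K, so \<omega>(4R) is controlled by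
    \<open>f K\<close>, and \<open>g k\<close> is the term of \<open>f\<close> at the radius
    R/2^k.\<close>
  define R :: real where "R = 1 / 2 ^ (K + 2)"
  define g where "g k = f (k + (K + 2))" for k
  have R: "R > 0" "4 * R = 1 / 2 ^ K" "4 * R \<le> 1" unfolding R_def by (simp_all add: power_add)
  have Rk: "R / 2 ^ k = 1 / 2 ^ (k + (K + 2))" for k unfolding R_def by (simp add: power_add)
  have g_pos: "0 < g k" for k unfolding g_def by (rule f_pos)
  have g_le: "g k \<le> 1/2" for k
  proof -
    have "1 / (16 * (M + 1)) \<le> 1 / 2" using M0 by (intro divide_left_mono) auto
    then show ?thesis unfolding g_def using f_le[of "k + (K + 2)"] by linarith
  qed
  have g_sum: "8 * (M + 1) * (\<Sum>i<k. g i) \<le> 1/2" for k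
  proof -
    have "(\<Sum>i<k. g i) \<le> 1 / (16 * (M + 1))" unfolding g_def by (rule tail) simp
    then have "8 * (M + 1) * (\<Sum>i<k. g i) \<le> 8 * (M + 1) * (1 / (16 * (M + 1)))"
      using M0 by (intro mult_left_mono) auto
    also have "\<dots> = 1/2" using M0 by (simp add: field_simps)
    finally show ?thesis .
  qed
  have g_lim: "g \<longlonglongrightarrow> 0"
    using LIMSEQ_ignore_initial_segment[OF summable_LIMSEQ_zero[OF f_sum], of "K + 2"]
    unfolding g_def .

  \<comment> \<open>Twice this slope gives the height R / (4(M+1)) required by
    \<open>flat_start\<close>, so the slab \<open>S\<close> lies strictly inside the cone of slope
    \<sigma>.\<close>
  define \<sigma> where "\<sigma> = 1 / (8 * (M + 1))"
  have \<sigma>: "\<sigma> > 0" unfolding \<sigma>_def using M0 by simp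
  have \<sigma>2: "2 * \<sigma> * R = R / (4 * (M + 1))" unfolding \<sigma>_def using M0 by (simp add: field_simps)
  have "\<omega> (4 * R) \<le> \<sigma>"
  proof -
    have "\<omega> (4 * R) \<le> f K" using f_gt[of K] R(2) by simp
    also have "\<dots> \<le> 1 / (16 * (M + 1))" by (rule f_le) simp
    also have "\<dots> \<le> \<sigma>" unfolding \<sigma>_def using M0 by (intro divide_left_mono) auto
    finally show ?thesis .
  qed
  define G where "G = (ball 0 1 \<inter> {x. 1/4 * ?t x < x $ N}) \<union> (ball 0 (4 * R) \<inter> {x. \<sigma> * ?t x < x $ N})"
  note G = hopf_region[OF assms(3,4) R(1,3) \<sigma> \<open>\<omega> (4 * R) \<le> \<sigma>\<close>, of N, folded G_def]
  let ?a = "(1/2) *\<^sub>R axis N 1 :: real^'n"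
  have a: "norm ?a = 1/2" "?t ?a = 0" "?a $ N = 1/2"
    by (simp_all add: norm_perp_axis[symmetric] perp_linear perp_self)
  have aG: "?a \<in> G" unfolding G_def using a by simp
  define S where "S = {z. 2 * \<sigma> * R \<le> z $ N \<and> z $ N \<le> R \<and> ?t z \<le> R}"
  have S_bd: "S \<subseteq> cball 0 (2 * R)"
  proof
    fix z assume z: "z \<in> S"
    have "0 < 2 * \<sigma> * R" using \<sigma> R(1) by simp
    moreover have "2 * \<sigma> * R \<le> z $ N" "z $ N \<le> R" "?t z \<le> R" using z unfolding S_def by blast+
    ultimately have "\<bar>z $ N\<bar> \<le> R" "?t z \<le> R" by linarith+
    then show "z \<in> cball 0 (2 * R)" using norm_le_tangential[of z N] by simp
  qed
  have "closed S" unfolding S_def norm_perp_axis[symmetric] perp_def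
    by (intro closed_Collect_conj closed_Collect_le continuous_intros)
  then have S_cpt: "compact S"
    using bounded_subset[OF bounded_cball S_bd] by (simp add: compact_eq_bounded_closed)
  have SG: "S \<subseteq> G"
  proof
    fix z assume z: "z \<in> S"
    have "\<sigma> * ?t z \<le> \<sigma> * R" using z \<sigma> unfolding S_def by (intro mult_left_mono) auto
    moreover have "0 < \<sigma> * R" using \<sigma> R by simp
    moreover have "2 * (\<sigma> * R) \<le> z $ N" using z unfolding S_def by (simp only: mem_Collect_eq mult.assoc)
    ultimately have "\<sigma> * ?t z < z $ N" by linarith
    moreover have "norm z < 4 * R" using subsetD[OF S_bd z] R(1) by simp
    ultimately show "z \<in> G" unfolding G_def by simp
  qed
  \<comment> \<open>\<open>G\<close> and \<open>S\<close> are built from \<omega>, n, lam and Lam,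
    so the resulting \<open>c\<close> is fixed before l, \<Omega> and u. The smaller closed ball
    lies inside the ball over which the infimum is taken.\<close>
  have "propagates G (cball ?a (1/16)) S"
    by (rule propagates_compact[OF G(1,2) aG _ S_cpt SG]) simp
  then obtain c where c: "c > 0"
    and harnack: "\<And>D u m. \<lbrakk>admissible D u; G \<subseteq> D; 0 \<le> m; \<forall>x\<in>cball ?a (1/16). m \<le> u x\<rbrakk> \<Longrightarrow> \<forall>x\<in>S. c * m \<le> u x"
    unfolding propagates_def by meson

  show ?thesis
  proof (rule exI[of _ "c / (4 * R)"], intro conjI allI impI)
    show "0 < c / (4 * R)" using c R by simp
    fix l :: "real^'n" assume l: "norm l = 1 \<and> l $ N > 0"
    have "eventually (\<lambda>k. g k < l $ N / 8) sequentially"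
      using order_tendstoD(2)[OF g_lim, of "l $ N / 8"] l by simp
    \<comment> \<open>From scale \<open>k1\<close> on the error is small relative to l_n. The
      direction \<open>l\<close> enters through this index alone, hence affects \<delta> and not the
      constant.\<close>
    then obtain k1 where k1: "\<And>k. k1 \<le> k \<Longrightarrow> g k < l $ N / 8" unfolding eventually_sequentially by blast
    show "\<exists>\<delta>>0. \<forall>(\<Omega> :: (real^'n) set) (u :: real^'n \<Rightarrow> real).
      open \<Omega> \<and> connected \<Omega> \<and> interior_C1_Dini N 1 \<omega> \<Omega> \<and>
      pucci_supersolution lam Lam (\<Omega> \<inter> ball 0 1) u \<and>
      u 0 = 0 \<and> (\<forall>x\<in>\<Omega> \<inter> ball 0 1. 0 \<le> u x) \<longrightarrow>
      (\<forall>r. 0 < r \<and> r < \<delta> \<longrightarrow>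
        u (r *\<^sub>R l) \<ge> c / (4 * R) * l $ N * (INF x\<in>ball ?a (1/8). u x) * r)"
    proof (rule exI[of _ "R / 2 ^ Suc k1"], intro conjI allI impI)
      show "0 < R / 2 ^ Suc k1" using R by simp
      fix \<Omega> :: "(real^'n) set" and u :: "real^'n \<Rightarrow> real" and r :: real
      assume hyp: "open \<Omega> \<and> connected \<Omega> \<and> interior_C1_Dini N 1 \<omega> \<Omega> \<and>
          pucci_supersolution lam Lam (\<Omega> \<inter> ball 0 1) u \<and> u 0 = 0 \<and> (\<forall>x\<in>\<Omega> \<inter> ball 0 1. 0 \<le> u x)"
        and r: "0 < r \<and> r < R / 2 ^ Suc k1"
      let ?D = "\<Omega> \<inter> ball 0 1"
      define m where "m = (INF x\<in>ball ?a (1/8). u x)"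
      have adm: "admissible ?D u" unfolding admissible_def
        using hyp by (auto intro: bounded_subset[OF bounded_ball])
      have nn: "0 \<le> u x" if "x \<in> ?D" for x using hyp that by blast
      have region: "ball 0 1 \<inter> {x. ?t x * \<omega> (?t x) < x $ N} \<subseteq> ?D"
        using hyp unfolding interior_C1_Dini_def by auto
      then have GD: "G \<subseteq> ?D" using G(3) by blast
      have ballD: "ball ?a (1/8) \<subseteq> ?D"
      proof
        fix x assume "x \<in> ball ?a (1/8)"
        then have d: "norm (x - ?a) < 1/8" by (simp add: dist_norm norm_minus_commute)
        have "norm x \<le> norm (x - ?a) + norm ?a" by (metis diff_add_cancel norm_triangle_ineq)
        then have n: "norm x < 1" using d a by linarith
        have "?t x \<le> ?t (x - ?a) + ?t ?a" using tangential_norm_triangle[of N "x - ?a" ?a] by simp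
        then have t: "?t x < 1/8" using tangential_norm_le[of N "x - ?a"] d a by linarith
        have "\<bar>(x - ?a) $ N\<bar> < 1/8" using component_le_norm_cart[of "x - ?a" N] d by linarith
        moreover have "(x - ?a) $ N = x $ N - 1/2" using a by simp
        ultimately have "x $ N > 3/8" by linarith
        then have "x \<in> G" unfolding G_def using n t by simp
        then show "x \<in> ?D" using GD by blast
      qed
      \<comment> \<open>Without a lower bound the real-valued \<open>INF\<close> would not be a
        genuine lower bound; nonnegativity of \<open>u\<close> supplies one.\<close>
      have bdd: "bdd_below (u ` ball ?a (1/8))" using nn ballD by (intro bdd_belowI2[of _ 0]) blast
      have m_le: "m \<le> u x" if "x \<in> ball ?a (1/8)" for x
        unfolding m_def by (rule cINF_lower[OF bdd that])
      have m0: "0 \<le> m" unfolding m_def using nn ballD by (intro cINF_greatest) (simp, blast)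
      have low: "c * m \<le> u z" if "R / (4 * (M + 1)) \<le> z $ N" "z $ N \<le> R" "?t z \<le> R" for z
      proof -
        have "cball ?a (1/16) \<subseteq> ball ?a (1/8)" by (simp add: cball_subset_ball_iff)
        then have "\<forall>x\<in>S. c * m \<le> u x" using m_le by (intro harnack[OF adm GD m0]) blast
        then show ?thesis using that unfolding S_def \<sigma>2 by blast
      qed
      \<comment> \<open>Here the boundary condition enters the iteration: |z'| \<le> R/2^k gives
        |z'| \<omega>(|z'|) < g k R/2^k, so the part above the flat piece lies in \<Omega>.\<close>
      have cyl: "z \<in> ?D" if z: "g k * (R / 2 ^ k) \<le> z $ N" "z $ N \<le> R / 2 ^ k" "?t z \<le> R / 2 ^ k" for k z
      proof -
        have t0: "0 \<le> ?t z" by (rule tangential_norm_nonneg)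
        have Rk0: "0 < R / 2 ^ k" using R by simp
        have "\<omega> (?t z) \<le> \<omega> (R / 2 ^ k)" by (rule \<omega>_mono[OF t0 z(3)])
        then have "?t z * \<omega> (?t z) \<le> R / 2 ^ k * \<omega> (R / 2 ^ k)"
          using t0 z(3) \<omega>0[of "?t z"] Rk0 by (intro mult_mono) auto
        also have "\<dots> < R / 2 ^ k * g k"
          using Rk0 f_gt[of "k + (K + 2)"] unfolding Rk g_def by (intro mult_strict_left_mono) auto
        also have "\<dots> \<le> z $ N" using z(1) by (simp only: mult.commute)
        finally have "?t z * \<omega> (?t z) < z $ N" .
        moreover have "norm z < 1"
        proof -
          have "0 < z $ N" using z(1) mult_pos_pos[OF g_pos[of k] Rk0] by linarith
          moreover have "R / 2 ^ k \<le> R / 1" using R by (intro divide_left_mono) auto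
          ultimately show ?thesis using norm_le_tangential[of z N] z R(1,3) by simp
        qed
        ultimately show ?thesis using region by auto
      qed
      define d where "d = R / 2 ^ Suc k1"
      have d: "0 < d" "r \<le> d" unfolding d_def using R(1) r by simp_all
      then have "0 < r / d" "r / d \<le> 1" using r by (simp_all add: divide_le_eq_1)
      then obtain j where j: "1 / 2 ^ Suc j < r / d" "r / d \<le> 1 / 2 ^ j"
        using ex_dyadic_scale by blast
      \<comment> \<open>The scale matched to \<open>r\<close>: R/2^(k+2) < r \<le> R/2^(k+1), with k
        \<ge> k1.\<close>
      define k where "k = k1 + j"
      have "d / 2 ^ Suc j < r" "r \<le> d / 2 ^ j" using j d(1) by (simp_all add: field_simps)
      then have rk: "R / 2 ^ (k + 2) < r" "r \<le> R / 2 ^ Suc k"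
        unfolding k_def d_def by (simp_all add: power_add mult_ac)
      \<comment> \<open>As R/2^k < 4r and g k < l_n/8, the error is at most half the height l_n r of
        the point.\<close>
      have gl: "g k * (R / 2 ^ k) \<le> l $ N * r / 2"
      proof -
        have "R / 2 ^ k \<le> 4 * r" using rk(1) by (simp add: field_simps)
        then have "g k * (R / 2 ^ k) \<le> l $ N / 8 * (4 * r)"
          using k1[of k] g_pos[of k] R unfolding k_def by (intro mult_mono) auto
        then show ?thesis by (simp add: mult.commute)
      qed
      let ?x = "r *\<^sub>R l"
      have lN: "l $ N \<le> 1" using component_le_norm_cart[of l N] l by simp
      have xN: "?x $ N = l $ N * r" by (simp add: mult.commute)
      have xN_le: "?x $ N \<le> R / 2 ^ Suc k"
        using mult_right_mono[OF lN, of r] r rk(2) unfolding xN by linarith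
      have xt: "?t ?x \<le> R / 2 ^ Suc k"
        using tangential_norm_le[of N ?x] l r rk(2) by simp
      have lr: "0 < l $ N * r" using l r by simp
      have xD: "?x \<in> ?D"
      proof (rule cyl[of k])
        show "g k * (R / 2 ^ k) \<le> ?x $ N" unfolding xN using gl lr by linarith
        have "R / 2 ^ Suc k \<le> R / 2 ^ k" using R by (simp add: field_simps)
        then show "?x $ N \<le> R / 2 ^ k" "?t ?x \<le> R / 2 ^ k" using xN_le xt by linarith+
      qed
      have "c / (4 * R) * l $ N * m * r \<le> u ?x"
      \<comment> \<open>The iteration requires a positive starting bound c m.\<close>
      proof (cases "m = 0")
        case True
        then show ?thesis using nn[OF xD] by simp
      next
        case False
        then have cm: "c * m > 0" using c m0 by simp
        then have cmR: "0 < c * m / R" using R by simp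
        have half: "l $ N * r / 2 \<le> ?x $ N - g k * (R / 2 ^ k)" unfolding xN using gl by linarith
        \<comment> \<open>The factor 1/4 combines the half of the slope that survives the iteration
          with the half of the height left after subtracting the error.\<close>
        have "c / (4 * R) * l $ N * m * r = c * m / R * (1/2) * (l $ N * r / 2)" by simp
        also have "\<dots> \<le> c * m / R * (1/2) * (?x $ N - g k * (R / 2 ^ k))"
          using cmR by (intro mult_left_mono half) auto
        also have "\<dots> \<le> c * m / R * (1 - 8 * (M + 1) * (\<Sum>i<k. g i)) * (?x $ N - g k * (R / 2 ^ k))"
          using half lr cmR g_sum[of k] by (intro mult_right_mono mult_left_mono; linarith)
        also have "\<dots> \<le> u ?x"
          by (rule flat_iterate[OF adm R(1) cm g_pos g_le g_sum cyl low xD xN_le xt])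
        finally show ?thesis .
      qed
      then show "c / (4 * R) * l $ N * (INF x\<in>ball ?a (1/8). u x) * r \<le> u ?x" unfolding m_def .
    qed
  qed
qed

end
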